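(* Let $G=(V,E)$ be a finite graph with $N=|V|$ and maximum degree $\Delta\ge1$. Then for every integer $q\ge2$, every $\varepsilon>0$ and every $\beta\ge0$, the spectral gap of the Swendsen-Wang dynamics for the $q$-state Potts model on $G$ at inverse temperature $\beta$ satisfies $$\lambda\bigl(P^G_{\beta,q}\bigr)^{-1}\;\le\;\frac{c}{\varepsilon}\,N\log N,\qquad\text{where } c^{-1}=\tfrac14\,c_{\rm SW}(G,\beta,q),$$ if $$\beta\le 2\,\frac{1-\varepsilon}{\Delta},$$ or if $G$ is planar, $\Delta\ge6$ and $$\beta\le\frac{1-\varepsilon}{\sqrt{3(\Delta-3)}}.$$
   Context: Graphs are finite, with vertex set $V$ and edge set $E\subseteq\binom V2$ (simple, undirected). $[q]=\{1,\dots,q\}$, $\Omega_{\rm P}=[q]^V$, and $c_{\rm SW}(G,\beta,q):=\frac{1}{2q^2}\left(q\,e^{2\beta}\right)^{-4\Delta}$. Potts model: for $\sigma\in\Omega_{\rm P}$ put $E(\sigma):=\{\{u,v\}\in E:\sigma(u)=\sigma(v)\}$. The Boltzmann distribution is $\pi^{G}_{\beta,q}(\sigma)=\frac1Z\exp(\beta\,|E(\sigma)|)$, with $Z$ the normalizing constant. Swendsen-Wang dynamics: with $p=1-e^{-\beta}$ and $C(A)$ the number of connected components of $(V,A)$ (isolated vertices counted), $$P^G_{\beta,q}(\sigma,\tau)=\sum_{A\subseteq E(\sigma)\cap E(\tau)}p^{|A|}(1-p)^{|E(\sigma)|-|A|}\,q^{-C(A)},\qquad \sigma,\tau\in\Omega_{\rm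 P}$$ (convention $0^0=1$); it is reversible with respect to $\pi^G_{\beta,q}$. Spectral gap: for a transition matrix $K$ on a finite set $\Omega$ reversible with respect to a probability measure $\pi$, with (real) eigenvalues $1=\xi_0\ge\xi_1\ge\dots\ge\xi_{|\Omega|-1}\ge-1$, set $\lambda(K):=1-\max\{\xi_1,|\xi_{|\Omega|-1}|\}$. Here $\log$ is the natural logarithm. *)

theory Defs
  imports
    "HOL-Analysis.Path_Connected"
    "HOL-Library.FuncSet"
    "HOL-Library.Ramsey"
    "Jordan_Normal_Form.Char_Poly"
begin

section \<open>Finite simple graphs\<close>

definition finite_simple_graph :: "'v set \<Rightarrow> 'v set set \<Rightarrow> bool" where
  "finite_simple_graph V E \<longleftrightarrow> finite V \<and> E \<subseteq> nsets V 2"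

definition vertex_degree :: "'v set set \<Rightarrow> 'v \<Rightarrow> nat" where
  "vertex_degree E v = card {e \<in> E. v \<in> e}"

text \<open>The inserted \<open>0\<close> only matters for the graph without vertices.\<close>

definition max_degree :: "'v set \<Rightarrow> 'v set set \<Rightarrow> nat" where
  "max_degree V E = Max (insert 0 (vertex_degree E ` V))"

text \<open>Planarity is the existence of a plane drawing: vertices are distinct points, edges are simple
  arcs joining (in either direction) the two points of their ends and passing through no other
  vertex, and two distinct edges meet only in common ends.\<close>

definition plane_drawing ::
    "'v set \<Rightarrow> 'v set set \<Rightarrow> ('v \<Rightarrow> complex) \<Rightarrow> ('v set \<Rightarrow> real \<Rightarrow> complex) \<Rightarrow> bool" where
  "plane_drawing V E pt \<gamma> \<longleftrightarrow>
     inj_on pt V \<and>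
     (\<forall>e\<in>E. arc (\<gamma> e) \<and> {pathstart (\<gamma> e), pathfinish (\<gamma> e)} = pt ` e \<and>
             path_image (\<gamma> e) \<inter> pt ` V = pt ` e) \<and>
     (\<forall>e\<in>E. \<forall>e'\<in>E. e \<noteq> e' \<longrightarrow>
             path_image (\<gamma> e) \<inter> path_image (\<gamma> e') \<subseteq> pt ` (e \<inter> e'))"

definition planar_graph :: "'v set \<Rightarrow> 'v set set \<Rightarrow> bool" where
  "planar_graph V E \<longleftrightarrow> (\<exists>pt \<gamma>. plane_drawing V E pt \<gamma>)"

definition component_rel :: "'v set \<Rightarrow> 'v set set \<Rightarrow> ('v \<times> 'v) set" where
  "component_rel V A = {(x, y). {x, y} \<in> A}\<^sup>* \<inter> V \<times> V"

definition num_components :: "'v set \<Rightarrow> 'v set set \<Rightarrow> nat" where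
  "num_components V A = card (V // component_rel V A)"


section \<open>Potts model and Swendsen-Wang dynamics\<close>

definition potts_configs :: "'v set \<Rightarrow> nat \<Rightarrow> ('v \<Rightarrow> nat) set" where
  "potts_configs V q = V \<rightarrow>\<^sub>E {1..q}"

definition mono_edges :: "'v set set \<Rightarrow> ('v \<Rightarrow> nat) \<Rightarrow> 'v set set" where
  "mono_edges E \<sigma> = {{u, v} | u v. {u, v} \<in> E \<and> \<sigma> u = \<sigma> v}"

definition potts_partition :: "'v set \<Rightarrow> 'v set set \<Rightarrow> real \<Rightarrow> nat \<Rightarrow> real" where
  "potts_partition V E \<beta> q =
     (\<Sum>\<sigma>\<in>potts_configs V q. exp (\<beta> * real (card (mono_edges E \<sigma>))))"

definition potts_measure ::
    "'v set \<Rightarrow> 'v set set \<Rightarrow> real \<Rightarrow> nat \<Rightarrow> ('v \<Rightarrow> nat) \<Rightarrow> real" where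
  "potts_measure V E \<beta> q \<sigma> =
     exp (\<beta> * real (card (mono_edges E \<sigma>))) / potts_partition V E \<beta> q"

definition sw_kernel ::
    "'v set \<Rightarrow> 'v set set \<Rightarrow> real \<Rightarrow> nat \<Rightarrow> ('v \<Rightarrow> nat) \<Rightarrow> ('v \<Rightarrow> nat) \<Rightarrow> real" where
  "sw_kernel V E \<beta> q \<sigma> \<tau> =
     (let p = 1 - exp (- \<beta>) in
        \<Sum>A \<in> Pow (mono_edges E \<sigma> \<inter> mono_edges E \<tau>).
          p ^ card A * (1 - p) ^ (card (mono_edges E \<sigma>) - card A)
            * real q powi (- int (num_components V A)))"

definition c_SW :: "'v set \<Rightarrow> 'v set set \<Rightarrow> real \<Rightarrow> nat \<Rightarrow> real" where
  "c_SW V E \<beta> q =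
     1 / (2 * (real q)\<^sup>2) * (real q * exp (2 * \<beta>)) powi (- 4 * int (max_degree V E))"


section \<open>Spectral gap\<close>

definition reversible :: "'s set \<Rightarrow> ('s \<Rightarrow> 's \<Rightarrow> real) \<Rightarrow> ('s \<Rightarrow> real) \<Rightarrow> bool" where
  "reversible \<Omega> K \<mu> \<longleftrightarrow> (\<forall>x\<in>\<Omega>. \<forall>y\<in>\<Omega>. \<mu> x * K x y = \<mu> y * K y x)"

text \<open>The kernel as a matrix over an arbitrary enumeration of the state space; another enumeration
  gives a matrix that is conjugate by a permutation, hence has the same characteristic polynomial.\<close>

definition kernel_matrix :: "'s set \<Rightarrow> ('s \<Rightarrow> 's \<Rightarrow> real) \<Rightarrow> real mat" where
  "kernel_matrix \<Omega> K =
     (let s = (SOME s :: nat \<Rightarrow> 's. bij_betw s {..<card \<Omega>} \<Omega>) in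
        mat (card \<Omega>) (card \<Omega>) (\<lambda>(i, j). K (s i) (s j)))"

text \<open>The real eigenvalues with multiplicity, in decreasing order. If \<open>K\<close> is reversible with respect
  to a strictly positive weight, all eigenvalues are real and the list has length \<open>card \<Omega>\<close>.\<close>

definition eigenvalues_desc :: "'s set \<Rightarrow> ('s \<Rightarrow> 's \<Rightarrow> real) \<Rightarrow> real list" where
  "eigenvalues_desc \<Omega> K =
     rev (sorted_list_of_multiset (proots (char_poly (kernel_matrix \<Omega> K))))"

text \<open>Meaningful for kernels reversible as above with \<open>card \<Omega> \<ge> 2\<close>.\<close>

definition spectral_gap :: "'s set \<Rightarrow> ('s \<Rightarrow> 's \<Rightarrow> real) \<Rightarrow> real" where
  "spectral_gap \<Omega> K =
     (let \<xi> = eigenvalues_desc \<Omega> K in 1 - max (\<xi> ! 1) \<bar>\<xi> ! (card \<Omega> - 1)\<bar>)"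


section \<open>Reversibility of the dynamics\<close>

lemma finite_mono_edges:
  assumes "finite_simple_graph V E"
  shows "finite (mono_edges E \<sigma>)"
proof (rule finite_subset)
  show "mono_edges E \<sigma> \<subseteq> Pow V"
    using assms by (auto simp: mono_edges_def finite_simple_graph_def nsets_def)
  show "finite (Pow V)"
    using assms by (simp add: finite_simple_graph_def)
qed

lemma sw_reversible:
  assumes "finite_simple_graph V E"
  shows "reversible (potts_configs V q) (sw_kernel V E \<beta> q) (potts_measure V E \<beta> q)"
proof -
  have weight: "exp (\<beta> * real (card (mono_edges E \<sigma>))) * exp (- \<beta>) ^ (card (mono_edges E \<sigma>) - card A)
      = exp (\<beta> * real (card A))" if "A \<subseteq> mono_edges E \<sigma>" for A and \<sigma> :: "'a \<Rightarrow> nat"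
  proof -
    have "card A \<le> card (mono_edges E \<sigma>)"
      using that finite_mono_edges[OF assms] by (rule card_mono[rotated])
    then show ?thesis
      by (simp add: exp_of_nat_mult[symmetric] exp_add[symmetric] of_nat_diff algebra_simps)
  qed
  have eq: "potts_measure V E \<beta> q \<sigma> * sw_kernel V E \<beta> q \<sigma> \<tau> =
      (\<Sum>A \<in> Pow (mono_edges E \<sigma> \<inter> mono_edges E \<tau>).
         (1 - exp (- \<beta>)) ^ card A * exp (\<beta> * real (card A))
           * real q powi (- int (num_components V A))) / potts_partition V E \<beta> q" for \<sigma> \<tau>
    unfolding potts_measure_def sw_kernel_def Let_def sum_distrib_left sum_divide_distrib
  proof (rule sum.cong[OF refl])
    fix A assume "A \<in> Pow (mono_edges E \<sigma> \<inter> mono_edges E \<tau>)"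
    then have "A \<subseteq> mono_edges E \<sigma>" by blast
    from weight[OF this, symmetric]
    show "exp (\<beta> * real (card (mono_edges E \<sigma>))) / potts_partition V E \<beta> q *
        ((1 - exp (- \<beta>)) ^ card A * (1 - (1 - exp (- \<beta>))) ^ (card (mono_edges E \<sigma>) - card A) *
          real q powi (- int (num_components V A))) =
        (1 - exp (- \<beta>)) ^ card A * exp (\<beta> * real (card A)) *
          real q powi (- int (num_components V A)) / potts_partition V E \<beta> q"
      by simp
  qed
  show ?thesis
    unfolding reversible_def eq by (simp add: Int_commute)
qed

end

theory Submission
  imports Defs "HOL-Analysis.Jordan_Curve" "HOL-Analysis.Smooth_Paths"
    "Jordan_Normal_Form.Schur_Decomposition"
begin

text \<open>The Dirichlet form of the Swendsen-Wang dynamics is the average, over the percolation set \<open>A\<close>, of the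
  variance under uniform colourings of the components of \<open>A\<close>. Keeping only the sets \<open>A\<close> in which a given
  vertex \<open>v\<close> is isolated bounds it below by \<open>exp (- \<beta> * \<Delta>)\<close> times the heat-bath Dirichlet form at \<open>v\<close>;
  this constant is far better than \<open>c_SW\<close>.

  The heat-bath gap follows by tracking the vector of coordinate-wise oscillations of \<open>f\<close>: changing one
  neighbour moves the heat-bath law by at most \<open>tanh (\<beta> / 2) \<le> \<beta> / 2\<close> in total variation, so one step
  contracts the oscillation vector by \<open>1 - (1 - \<beta> * \<rho> / 2) / N\<close>, where \<open>\<rho>\<close> bounds the quadratic form of
  the adjacency matrix. Log-convexity of \<open>t \<mapsto> \<parallel>P\<^sup>t f\<parallel>\<^sup>2\<close> turns this asymptotic rate into a Poincare
  inequality.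

  Always \<open>\<rho> \<le> \<Delta>\<close>. For planar graphs every vertex set \<open>S\<close> spans at most \<open>3 * card S\<close> edges, and a
  layer-cake argument gives \<open>\<rho> \<le> 2 * sqrt (3 * (\<Delta> - 3))\<close>. The edge bound is proved from Janiszewski's
  theorem without Euler's formula: in a bridgeless plane graph every edge borders two faces and every
  face at least three edges, while the fundamental cycles of a spanning subgraph distinguish at least
  as many faces as there are edges outside it.\<close>

section \<open>Plane graphs\<close>

text \<open>The largest row sum of the adjacency matrix is \<open>\<Delta>\<close>, for planar
  graphs too, so a contraction of oscillations in the supremum norm could not see planarity. The
  Euclidean norm is used instead, because there only the quadratic form counts. Its price is a
  prefactor, depending on the graph and on the function, in front of the geometric decay;
  log-convexity, which comes from self-adjointness, makes that prefactor harmless. The heat bath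
  then has gap at least \<open>\<epsilon> / N\<close> as soon as
  \<open>\<beta> * \<rho> / 2 \<le> 1 - \<epsilon>\<close>, and inserting the two values of
  \<open>\<rho>\<close> gives the two conditions on \<open>\<beta>\<close>. In the planar case
  sparsity is needed for every induced subgraph, since the layers of the layer cake are superlevel
  sets of the squared test vector. Bridges lie on no cycle, so the face count cannot treat them;
  they are stripped off beforehand by induction.\<close>

lemma card_image_less: "finite A \<Longrightarrow> \<not> inj_on f A \<Longrightarrow> card (f ` A) < card A"
  using card_image_le[of A f] eq_card_imp_inj_on[of A f] by linarith

abbreviation reach :: "'v set set \<Rightarrow> ('v \<times> 'v) set" where
  "reach H \<equiv> {(x, y). {x, y} \<in> H}\<^sup>*"

lemma sym_reach: "sym (reach H)"
  by (rule sym_rtrancl) (auto simp: sym_def insert_commute)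

lemma reach_mono: "H \<subseteq> H' \<Longrightarrow> reach H \<subseteq> reach H'"
  by (rule rtrancl_mono) auto

section \<open>Topology of plane drawings: faces, cycles and the edges they border\<close>

locale plane_graph =
  fixes V :: "'v set" and E :: "'v set set"
    and pt :: "'v \<Rightarrow> complex" and \<gamma> :: "'v set \<Rightarrow> real \<Rightarrow> complex"
  assumes graph: "finite_simple_graph V E" and drawing: "plane_drawing V E pt \<gamma>"
begin

text \<open>All of \<open>V\<close> is kept whatever \<open>H\<close> is, so that deleting an edge
  removes exactly its open arc and skeletons of different edge sets are easy to compare.\<close>

definition skeleton :: "'v set set \<Rightarrow> complex set" where
  "skeleton H = pt ` V \<union> (\<Union>e\<in>H. path_image (\<gamma> e))"

definition open_edge :: "'v set \<Rightarrow> complex set" where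
  "open_edge e = path_image (\<gamma> e) - pt ` e"

text \<open>One common point suffices: \<open>connected_face_Un_edge\<close> extends the contact to
  the whole open edge.\<close>

definition borders :: "complex set \<Rightarrow> 'v set \<Rightarrow> bool" where
  "borders F e \<longleftrightarrow> frontier F \<inter> open_edge e \<noteq> {}"

lemma finite_V: "finite V" and finite_E: "finite E"
proof -
  show "finite V" using graph by (simp add: finite_simple_graph_def)
  then show "finite E" using graph
    by (auto simp: finite_simple_graph_def nsets_def intro: finite_subset[of E "Pow V"])
qed

lemma edge_arc: "e \<in> E \<Longrightarrow> arc (\<gamma> e)"
  and edge_ends: "e \<in> E \<Longrightarrow> {pathstart (\<gamma> e), pathfinish (\<gamma> e)} = pt ` e"
  and edge_subset: "e \<in> E \<Longrightarrow> e \<subseteq> V"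
  and card_edge: "e \<in> E \<Longrightarrow> card e = 2"
  using drawing graph by (auto simp: plane_drawing_def finite_simple_graph_def nsets_def)

lemma edgeE:
  assumes "e \<in> E"
  obtains u v where "e = {u, v}" "u \<in> V" "v \<in> V" "u \<noteq> v"
    "pathstart (\<gamma> e) = pt u" "pathfinish (\<gamma> e) = pt v"
proof -
  obtain u v where e: "e = {u, v}" "u \<noteq> v"
    using card_edge[OF assms] by (auto simp: card_2_iff)
  have V: "u \<in> V" "v \<in> V" using edge_subset[OF assms] e by auto
  have "{pathstart (\<gamma> e), pathfinish (\<gamma> e)} = {pt u, pt v}"
    using edge_ends[OF assms] e by auto
  then consider "pathstart (\<gamma> e) = pt u" "pathfinish (\<gamma> e) = pt v"
    | "pathstart (\<gamma> e) = pt v" "pathfinish (\<gamma> e) = pt u"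
    by (auto simp: doubleton_eq_iff)
  then show thesis
  proof cases
    case 1 then show ?thesis using that[of u v] e V by auto
  next
    case 2 then show ?thesis using that[of v u] e V by (simp add: insert_commute)
  qed
qed

lemma ends_on_edge: "e \<in> E \<Longrightarrow> pt ` e \<subseteq> path_image (\<gamma> e)"
  unfolding edge_ends[symmetric] by (simp add: pathstart_in_path_image pathfinish_in_path_image)

lemma compact_skeleton: "H \<subseteq> E \<Longrightarrow> compact (skeleton H)"
proof -
  assume H: "H \<subseteq> E"
  have "compact (\<Union>e\<in>H. path_image (\<gamma> e))"
    using H finite_E by (intro compact_UN) (auto intro: finite_subset edge_arc arc_imp_path compact_path_image)
  moreover have "compact (pt ` V)" using finite_V by (intro finite_imp_compact) auto
  ultimately show ?thesis unfolding skeleton_def by (intro compact_Un)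
qed

lemma skeleton_insert: "skeleton (insert e H) = path_image (\<gamma> e) \<union> skeleton H"
  by (auto simp: skeleton_def)

lemma edge_Int_skeleton:
  assumes "e \<in> E" "H \<subseteq> E" "e \<notin> H"
  shows "path_image (\<gamma> e) \<inter> skeleton H = pt ` e"
proof -
  have "path_image (\<gamma> e) \<inter> path_image (\<gamma> e') \<subseteq> pt ` e" if "e' \<in> H" for e'
  proof -
    have "path_image (\<gamma> e) \<inter> path_image (\<gamma> e') \<subseteq> pt ` (e \<inter> e')"
      using drawing assms that unfolding plane_drawing_def by (metis subsetD)
    then show ?thesis by blast
  qed
  moreover have "path_image (\<gamma> e) \<inter> pt ` V = pt ` e"
    using drawing assms(1) by (auto simp: plane_drawing_def)
  ultimately show ?thesis by (auto simp: skeleton_def)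
qed

lemma open_edge_eq: "e \<in> E \<Longrightarrow> open_edge e = path_image (\<gamma> e) - {pathstart (\<gamma> e), pathfinish (\<gamma> e)}"
  by (simp add: open_edge_def edge_ends)

lemma connected_open_edge: "e \<in> E \<Longrightarrow> connected (open_edge e)"
  unfolding open_edge_eq by (intro connected_simple_path_endless arc_imp_simple_path edge_arc)

lemma open_edge_nonempty: "e \<in> E \<Longrightarrow> open_edge e \<noteq> {}"
  unfolding open_edge_eq by (intro nonempty_simple_path_endless arc_imp_simple_path edge_arc)

lemma open_edge_disjoint:
  "e \<in> E \<Longrightarrow> H \<subseteq> E \<Longrightarrow> e \<notin> H \<Longrightarrow> open_edge e \<inter> skeleton H = {}"
  using edge_Int_skeleton[of e H] by (auto simp: open_edge_def)

lemma skeleton_remove: "e \<in> E \<Longrightarrow> skeleton E = skeleton (E - {e}) \<union> open_edge e"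
  using skeleton_insert[of e "E - {e}"] edge_subset[of e]
  by (auto simp: insert_absorb open_edge_def skeleton_def)

text \<open>Every set between \<open>F\<close> and its closure is connected, so the frontier point
  \<open>p\<close> may be added to \<open>F\<close>; the connected open edge is then attached at
  \<open>p\<close>.\<close>

lemma connected_face_Un_edge:
  assumes "connected F" "borders F e" "e \<in> E"
  shows "connected (F \<union> open_edge e)"
proof -
  obtain p where p: "p \<in> frontier F" "p \<in> open_edge e"
    using assms(2) by (auto simp: borders_def)
  have "connected (insert p F)"
    using p by (intro connected_intermediate_closure[OF assms(1)])
      (auto simp: frontier_def closure_subset[THEN subsetD])
  then have "connected (insert p F \<union> open_edge e)"
    using p connected_open_edge[OF assms(3)] by (intro connected_Un) auto
  then show ?thesis using p by (simp add: insert_absorb)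
qed

lemma connected_faces_Un_edge:
  assumes "connected F" "borders F e" "connected F'" "borders F' e" "e \<in> E"
  shows "connected (F \<union> F' \<union> open_edge e)"
proof -
  have "connected ((F \<union> open_edge e) \<union> (F' \<union> open_edge e))"
    using assms open_edge_nonempty by (intro connected_Un connected_face_Un_edge) auto
  then show ?thesis by (simp add: Un_ac)
qed

lemma face_connected: "F \<in> components (- skeleton E) \<Longrightarrow> connected F"
  by (rule in_components_connected)

lemma face_disjoint: "F \<in> components (- skeleton E) \<Longrightarrow> F \<inter> skeleton E = {}"
  using in_components_subset by fastforce

lemma face_eq:
  assumes "F \<in> components S" "x \<in> F"
  shows "F = connected_component_set S x"
proof -
  obtain a where a: "F = connected_component_set S a" using assms(1) by (auto simp: components_def)
  then show ?thesis using connected_component_eq[of x S a] assms(2) by simp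
qed

text \<open>Janiszewski's theorem for the cycle \<open>?S\<close> and the drawing \<open>?T\<close>
  without \<open>e\<close>. Their intersection is the connected set \<open>G\<close>. The points
  \<open>x\<close> and \<open>y\<close> are not separated by \<open>?S\<close> by assumption, nor by
  \<open>?T\<close>, because \<open>F\<close> and \<open>F'\<close> are joined through the open
  edge. Hence the union, which is the full skeleton, does not separate them.\<close>

lemma faces_eq:
  assumes e: "e \<in> E" and F: "F \<in> components (- skeleton E)" "borders F e"
    and F': "F' \<in> components (- skeleton E)" "borders F' e"
    and G: "compact G" "connected G" "G \<subseteq> skeleton (E - {e})" "pt ` e \<subseteq> G"
    and xy: "x \<in> F" "y \<in> F'" "connected_component (- (path_image (\<gamma> e) \<union> G)) x y"
  shows "F = F'"
proof -
  let ?S = "path_image (\<gamma> e) \<union> G" and ?T = "skeleton (E - {e})"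
  have "compact ?S" using e G by (auto intro: edge_arc[THEN arc_imp_path] compact_path_image)
  moreover have "closed ?T" by (simp add: compact_skeleton compact_imp_closed)
  moreover have "?S \<inter> ?T = G"
    using edge_Int_skeleton[OF e, of "E - {e}"] G by auto
  moreover have "connected_component (- ?T) x y"
  proof -
    have "connected (F \<union> F' \<union> open_edge e)"
      using assms by (intro connected_faces_Un_edge face_connected)
    moreover have "F \<union> F' \<union> open_edge e \<subseteq> - ?T"
      using face_disjoint[OF F(1)] face_disjoint[OF F'(1)] open_edge_disjoint[OF e, of "E - {e}"]
        skeleton_remove[OF e] by auto
    ultimately show ?thesis using xy unfolding connected_component_def by blast
  qed
  ultimately have "connected_component (- (?S \<union> ?T)) x y"
    using Janiszewski G(2) xy(3) by metis
  moreover have "?S \<union> ?T = skeleton E"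
    using skeleton_insert[of e "E - {e}"] G(3) e by (auto simp: insert_absorb)
  ultimately show ?thesis
    using face_eq[OF F(1) xy(1)] face_eq[OF F'(1) xy(2)] connected_component_eq[of y] by simp
qed

lemma path_component_skeleton:
  assumes H: "H \<subseteq> E" and u: "u \<in> V" and uv: "(u, v) \<in> reach H"
  shows "path_component (skeleton H) (pt u) (pt v)"
  using uv
proof (induction rule: rtrancl_induct)
  case base
  then show ?case using u by (auto simp: skeleton_def intro: path_component_refl)
next
  case (step y z)
  then have e: "{y, z} \<in> H" by auto
  let ?e = "{y, z}"
  have "path_component (skeleton H) (pt y) (pt z)"
  proof (rule path_component_of_subset)
    show "path_image (\<gamma> ?e) \<subseteq> skeleton H" using e by (auto simp: skeleton_def)
    have "pt y \<in> path_image (\<gamma> ?e)" "pt z \<in> path_image (\<gamma> ?e)"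
      using ends_on_edge[of ?e] e H by auto
    moreover have "path_connected (path_image (\<gamma> ?e))"
      using e H by (intro path_connected_path_image arc_imp_path edge_arc) auto
    ultimately show "path_component (path_image (\<gamma> ?e)) (pt y) (pt z)"
      by (simp add: path_connected_component)
  qed
  with step.IH show ?case by (rule path_component_trans)
qed

text \<open>\<open>G\<close> is the return part of the Jordan curve \<open>c\<close>. It is a
  separate parameter because it becomes the connected intersection in Janiszewski's theorem.\<close>

definition edge_cycle :: "'v set \<Rightarrow> (real \<Rightarrow> complex) \<Rightarrow> complex set \<Rightarrow> bool" where
  "edge_cycle e c G \<longleftrightarrow> simple_path c \<and> pathfinish c = pathstart c \<and>
     path_image c = path_image (\<gamma> e) \<union> G \<and> compact G \<and> connected G \<and> pt ` e \<subseteq> G"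

text \<open>The return arc is found topologically: a path-connected set is arcwise connected, and an
  arc inside \<open>skeleton H\<close> meets \<open>e\<close> only at its ends because
  \<open>e\<close> is not in \<open>H\<close>. This avoids extracting a simple path from the walk in
  \<open>H\<close>.\<close>

lemma cycle_through:
  assumes e: "e \<in> E" "e = {u, v}" and H: "H \<subseteq> E" "e \<notin> H" and uv: "(u, v) \<in> reach H"
  obtains c G where "edge_cycle e c G" "G \<subseteq> skeleton H"
proof -
  let ?a = "pathstart (\<gamma> e)" and ?b = "pathfinish (\<gamma> e)"
  have ab: "{?a, ?b} = {pt u, pt v}" "?a \<noteq> ?b"
    using edge_ends[OF e(1)] e arc_distinct_ends[OF edge_arc[OF e(1)]] by auto
  have "u \<in> V" "v \<in> V" using edge_subset[OF e(1)] e by auto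
  then have "path_component (skeleton H) (pt u) (pt v)"
    using path_component_skeleton[OF H(1) _ uv] by auto
  then have "path_component (skeleton H) ?b ?a"
    using ab(1) path_component_sym[of "skeleton H" "pt u" "pt v"] by (auto simp: doubleton_eq_iff)
  then have "?b \<in> path_component_set (skeleton H) ?b" "?a \<in> path_component_set (skeleton H) ?b"
    by (auto intro: path_component_refl dest: path_component_mem)
  moreover have "path_connected (path_component_set (skeleton H) ?b)" by simp
  ultimately obtain g where g: "arc g" "path_image g \<subseteq> path_component_set (skeleton H) ?b"
      "pathstart g = ?b" "pathfinish g = ?a"
    using ab(2) unfolding path_connected_arcwise by metis
  have gs: "path_image g \<subseteq> skeleton H"
    using g(2) path_component_subset by blast
  have "path_image (\<gamma> e) \<inter> path_image g \<subseteq> {?a, pathstart g}"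
    using edge_Int_skeleton[OF e(1) H] edge_ends[OF e(1)] gs g by auto
  then have "simple_path (\<gamma> e +++ g)"
    using g edge_arc[OF e(1)] by (intro simple_path_join_loop) auto
  moreover have "pt ` e \<subseteq> path_image g"
    using g pathstart_in_path_image[of g] pathfinish_in_path_image[of g]
    unfolding edge_ends[OF e(1), symmetric] by auto
  moreover have "compact (path_image g)" "connected (path_image g)"
    using g by (auto intro: compact_path_image connected_path_image arc_imp_path)
  ultimately have "edge_cycle e (\<gamma> e +++ g) (path_image g)"
    using g by (simp add: edge_cycle_def path_image_join)
  then show thesis using gs by (rule that)
qed

lemma connected_inside:
  fixes X :: "complex set"
  assumes "connected F" "F \<inter> X = {}" "F \<inter> inside X \<noteq> {}"
  shows "F \<subseteq> inside X"
proof
  fix y assume "y \<in> F"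
  obtain x where x: "x \<in> F" "x \<in> inside X" using assms(3) by auto
  then have "connected_component (- X) x y"
    using assms \<open>y \<in> F\<close> unfolding connected_component_def by blast
  then show "y \<in> inside X" using x inside_same_component by blast
qed

lemma connected_outside:
  fixes X :: "complex set"
  assumes "connected F" "F \<inter> X = {}" "F \<inter> outside X \<noteq> {}"
  shows "F \<subseteq> outside X"
  using connected_inside[OF assms(1,2)] assms(2,3) inside_Un_outside[of X] inside_Int_outside[of X]
  by blast

text \<open>Near an interior point \<open>p\<close> of \<open>e\<close> the drawing consists of
  \<open>e\<close> alone. A point \<open>z\<close> of \<open>X\<close> close to \<open>p\<close>
  lies in some face, and the segment from \<open>z\<close> to \<open>p\<close> must leave that face;
  it does so on the drawing, hence on \<open>e\<close>.\<close>

lemma face_near: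
  assumes e: "e \<in> E" and X: "path_image (\<gamma> e) \<subseteq> frontier X" "X \<inter> path_image (\<gamma> e) = {}"
  obtains F where "F \<in> components (- skeleton E)" "borders F e" "F \<inter> X \<noteq> {}"
proof -
  obtain p where p: "p \<in> open_edge e" using open_edge_nonempty[OF e] by auto
  have cl: "closed (skeleton (E - {e}))" "closed (skeleton E)"
    by (auto intro: compact_imp_closed compact_skeleton)
  have "p \<in> - skeleton (E - {e})" using p open_edge_disjoint[OF e, of "E - {e}"] by auto
  then obtain d where d: "d > 0" "ball p d \<subseteq> - skeleton (E - {e})"
    using cl(1) by (meson open_Compl open_contains_ball)
  have "p \<in> frontier X" using p X by (auto simp: open_edge_def)
  then obtain z where z: "z \<in> X" "dist p z < d"
    using d(1) frontier_straddle[of p X] by blast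
  have zE: "z \<in> - skeleton E"
    using z d(2) X(2) skeleton_remove[OF e] by (auto simp: open_edge_def)
  define F where "F = connected_component_set (- skeleton E) z"
  have F: "F \<in> components (- skeleton E)" using zE by (auto simp: F_def components_def)
  have "z \<in> F" using zE by (auto simp: F_def)
  have "p \<notin> F" using face_disjoint[OF F] p skeleton_remove[OF e] by auto
  have sub: "closed_segment z p \<subseteq> ball p d"
    using z(2) d(1) by (intro closed_segment_subset) (auto simp: dist_commute)
  have "closed_segment z p \<inter> frontier F \<noteq> {}"
    using \<open>z \<in> F\<close> \<open>p \<notin> F\<close> by (intro connected_Int_frontier) auto
  then obtain w where w: "w \<in> closed_segment z p" "w \<in> frontier F" by auto
  then have "w \<in> skeleton E"
    using frontier_of_components_closed_complement[OF cl(2) F] by auto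
  moreover have "w \<notin> skeleton (E - {e})" using w(1) sub d(2) by auto
  ultimately have "w \<in> open_edge e" using skeleton_remove[OF e] by auto
  then have "borders F e" using w(2) by (auto simp: borders_def)
  then show thesis using that[OF F] \<open>z \<in> F\<close> z(1) by blast
qed

text \<open>Both sides of the Jordan curve have \<open>e\<close> in their frontier, so
  \<open>face_near\<close> gives a face on each. Any face bordering \<open>e\<close> has a point in
  one of the two connected sides, and \<open>faces_eq\<close> identifies it with the face already
  found there.\<close>

lemma edge_faces:
  assumes e: "e \<in> E" and c: "edge_cycle e c G" and G: "G \<subseteq> skeleton (E - {e})"
  obtains F F' where "F \<subseteq> inside (path_image c)" "F' \<subseteq> outside (path_image c)"
    "{F \<in> components (- skeleton E). borders F e} = {F, F'}"
proof -
  let ?X = "path_image c"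
  have X: "?X = path_image (\<gamma> e) \<union> G" "compact G" "connected G" "pt ` e \<subseteq> G"
    and J: "open (inside ?X)" "connected (inside ?X)" "open (outside ?X)" "connected (outside ?X)"
      "frontier (inside ?X) = ?X" "frontier (outside ?X) = ?X"
    using c Jordan_inside_outside[of c] unfolding edge_cycle_def by simp_all
  have XE: "?X \<subseteq> skeleton E"
    using X(1) G e by (auto simp: skeleton_def)
  have dj: "F \<inter> ?X = {}" if "F \<in> components (- skeleton E)" for F
    using face_disjoint[OF that] XE by auto
  obtain F where F: "F \<in> components (- skeleton E)" "borders F e" "F \<inter> inside ?X \<noteq> {}"
  proof (rule face_near[OF e, of "inside ?X"])
    show "path_image (\<gamma> e) \<subseteq> frontier (inside ?X)" using J(5) X(1) by simp
    show "inside ?X \<inter> path_image (\<gamma> e) = {}" using inside_no_overlap[of ?X] unfolding X(1) by blast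
  qed
  have Fi: "F \<subseteq> inside ?X"
    by (rule connected_inside[OF face_connected[OF F(1)] dj[OF F(1)] F(3)])
  obtain F' where F': "F' \<in> components (- skeleton E)" "borders F' e" "F' \<inter> outside ?X \<noteq> {}"
  proof (rule face_near[OF e, of "outside ?X"])
    show "path_image (\<gamma> e) \<subseteq> frontier (outside ?X)" using J(6) X(1) by simp
    show "outside ?X \<inter> path_image (\<gamma> e) = {}" using outside_no_overlap[of ?X] unfolding X(1) by blast
  qed
  have F'o: "F' \<subseteq> outside ?X"
    by (rule connected_outside[OF face_connected[OF F'(1)] dj[OF F'(1)] F'(3)])
  have "F1 = F \<or> F1 = F'" if F1: "F1 \<in> components (- skeleton E)" "borders F1 e" for F1
  proof -
    obtain x where x: "x \<in> F1" using in_components_nonempty[OF F1(1)] by auto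
    then have "x \<in> - ?X" using dj[OF F1(1)] by auto
    then consider "x \<in> inside ?X" | "x \<in> outside ?X" using inside_Un_outside[of ?X] by blast
    then show ?thesis
    proof cases
      case 1
      obtain y where y: "y \<in> F" using F by auto
      then have "connected_component (- ?X) x y"
        using 1 Fi inside_Un_outside[of ?X] by (intro connected_componentI[OF J(2)]) blast+
      then show ?thesis using faces_eq[OF e F1 F(1,2) X(2,3) G X(4) x y] X(1) by simp
    next
      case 2
      obtain y where y: "y \<in> F'" using F' by auto
      then have "connected_component (- ?X) x y"
        using 2 F'o inside_Un_outside[of ?X] by (intro connected_componentI[OF J(4)]) blast+
      then show ?thesis using faces_eq[OF e F1 F'(1,2) X(2,3) G X(4) x y] X(1) by simp
    qed
  qed
  then have "{F \<in> components (- skeleton E). borders F e} = {F, F'}" using F F' by auto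
  then show thesis by (rule that[OF Fi F'o])
qed

text \<open>Points are added one at a time: a singleton meets any set in a connected set, so
  Janiszewski's theorem applies.\<close>

lemma connected_Compl_Un_finite:
  fixes S :: "complex set"
  assumes "finite P" "closed S" "connected (- S)"
  shows "connected (- (S \<union> P))"
  using assms(1)
proof (induction P rule: finite_induct)
  case empty
  then show ?case using assms by simp
next
  case (insert p P)
  have "connected (- ({p} \<union> (S \<union> P)))"
  proof (rule Janiszewski_connected)
    show "closed (S \<union> P)" by (rule closed_Un[OF assms(2) finite_imp_closed]) (rule insert)
    show "connected ({p} \<inter> (S \<union> P))" by (cases "p \<in> S \<union> P") auto
    show "connected (- {p})" by (rule connected_punctured_universe) simp
  qed (use insert in auto)
  then show ?case by simp
qed

text \<open>Simplicity of the graph enters here: two distinct edges share at most one end, so their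
  arcs meet in a connected set and cannot separate the plane. Two parallel edges would form a closed
  curve.\<close>

lemma connected_Compl_skeleton:
  assumes D: "D \<subseteq> E" "card D \<le> 2"
  shows "connected (- skeleton D)"
proof -
  have fin: "finite D" using D finite_E finite_subset by auto
  have arc: "connected (- path_image (\<gamma> e))" "compact (path_image (\<gamma> e))" if "e \<in> E" for e
    using that by (auto intro!: connected_arc_complement edge_arc compact_path_image arc_imp_path)
  have "closed (\<Union>e\<in>D. path_image (\<gamma> e)) \<and> connected (- (\<Union>e\<in>D. path_image (\<gamma> e)))"
  proof -
    consider "D = {}" | e where "D = {e}" | e e' where "D = {e, e'}" "e \<noteq> e'"
    proof -
      have "card D = 0 \<or> card D = 1 \<or> card D = 2" using D(2) by auto
      then show thesis using that fin by (auto simp: card_1_singleton_iff card_2_iff)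
    qed
    then show ?thesis
    proof cases
      case 1 then show ?thesis by (simp add: connected_UNIV)
    next
      case 2 then show ?thesis using D arc by (auto intro: compact_imp_closed)
    next
      case 3
      then have e: "e \<in> E" "e' \<in> E" using D by auto
      obtain a b where ab: "e = {a, b}" "a \<noteq> b" using card_edge[OF e(1)] by (auto simp: card_2_iff)
      have "\<not> {a, b} \<subseteq> e'"
        using card_edge[OF e(2)] 3(2) ab by (auto simp: card_2_iff)
      then have "e \<inter> e' \<subseteq> {a} \<or> e \<inter> e' \<subseteq> {b}" using ab by auto
      then obtain x where "e \<inter> e' \<subseteq> {x}" by blast
      moreover have "path_image (\<gamma> e) \<inter> path_image (\<gamma> e') \<subseteq> pt ` (e \<inter> e')"
        using drawing e 3 unfolding plane_drawing_def by blast
      ultimately have "path_image (\<gamma> e) \<inter> path_image (\<gamma> e') \<subseteq> {pt x}" by blast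
      then have "connected (path_image (\<gamma> e) \<inter> path_image (\<gamma> e'))"
        by (auto dest!: subset_singletonD)
      then have "connected (- (path_image (\<gamma> e) \<union> path_image (\<gamma> e')))"
        using arc e by (intro Janiszewski_connected) (auto intro: compact_imp_closed)
      moreover have "closed (path_image (\<gamma> e) \<union> path_image (\<gamma> e'))"
        using arc e by (intro closed_Un compact_imp_closed)
      ultimately show ?thesis using 3(1) by simp
    qed
  qed
  then show ?thesis
    unfolding skeleton_def Un_commute[of "pt ` V"]
    using finite_V by (intro connected_Compl_Un_finite) auto
qed

text \<open>Otherwise the edges bordering \<open>F\<close> would leave the plane connected. As there
  is a second face, the frontier of \<open>F\<close> would have a point off those edges and off all
  vertices; it lies inside another edge, which would then border \<open>F\<close> after all.\<close>

lemma three_edges_on_face: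
  assumes F: "F \<in> components (- skeleton E)" and e: "e \<in> E" "borders F e"
    and c: "edge_cycle e c G" and G: "G \<subseteq> skeleton (E - {e})"
  shows "3 \<le> card {e \<in> E. borders F e}"
proof (rule ccontr)
  let ?D = "{e \<in> E. borders F e}"
  assume "\<not> ?thesis"
  then have con: "connected (- skeleton ?D)" by (intro connected_Compl_skeleton) auto
  obtain F1 F2 where F12: "F1 \<subseteq> inside (path_image c)" "F2 \<subseteq> outside (path_image c)"
    "{F \<in> components (- skeleton E). borders F e} = {F1, F2}"
    by (rule edge_faces[OF e(1) c G])
  have "F1 \<in> {F \<in> components (- skeleton E). borders F e}"
    "F2 \<in> {F \<in> components (- skeleton E). borders F e}" unfolding F12(3) by auto
  then have comp: "F1 \<in> components (- skeleton E)" "F2 \<in> components (- skeleton E)" by auto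
  \<comment> \<open>The cycle through \<open>e\<close> is what guarantees a face other than
    \<open>F\<close>.\<close>
  have "F1 \<noteq> F2"
    using F12(1,2) inside_Int_outside[of "path_image c"] in_components_nonempty[OF comp(1)] by blast
  moreover have "F \<in> {F1, F2}" using F e(2) F12(3) by blast
  ultimately obtain F' where F': "F' \<in> components (- skeleton E)" "F' \<noteq> F"
    using comp by blast
  then have "F \<inter> F' = {}" using F components_nonoverlap by metis
  have sub: "skeleton ?D \<subseteq> skeleton E" by (auto simp: skeleton_def)
  have "- skeleton ?D \<inter> F \<noteq> {}"
    using in_components_nonempty[OF F] face_disjoint[OF F] sub by blast
  moreover have "- skeleton ?D - F \<noteq> {}"
    using in_components_nonempty[OF F'(1)] face_disjoint[OF F'(1)] sub \<open>F \<inter> F' = {}\<close> by blast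
  ultimately have "- skeleton ?D \<inter> frontier F \<noteq> {}" by (rule connected_Int_frontier[OF con])
  then obtain w where w: "w \<notin> skeleton ?D" "w \<in> frontier F" by auto
  have "closed (skeleton E)" by (intro compact_imp_closed compact_skeleton) simp
  then have "w \<in> skeleton E" using frontier_of_components_closed_complement[OF _ F] w(2) by auto
  then obtain e' where e': "e' \<in> E" "w \<in> path_image (\<gamma> e')" using w(1) by (auto simp: skeleton_def)
  moreover have "w \<notin> pt ` e'" using w(1) edge_subset[OF e'(1)] by (auto simp: skeleton_def)
  ultimately have "borders F e'" using w(2) by (auto simp: borders_def open_edge_def)
  then have "w \<in> skeleton ?D" using e' by (auto simp: skeleton_def)
  then show False using w(1) by simp
qed

section \<open>Counting edges by faces and by fundamental cycles\<close>

lemma inside_eq_across_edge: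
  assumes F: "F \<in> components (- skeleton E)" "borders F e"
    and F': "F' \<in> components (- skeleton E)" "borders F' e"
    and e: "e \<in> E" and H: "H \<subseteq> E" "e \<notin> H" and X: "X \<subseteq> skeleton H"
  shows "F \<subseteq> inside X \<longleftrightarrow> F' \<subseteq> inside X"
proof -
  let ?U = "F \<union> F' \<union> open_edge e"
  have con: "connected ?U" using assms by (intro connected_faces_Un_edge face_connected)
  have "skeleton H \<subseteq> skeleton E" using H by (auto simp: skeleton_def)
  \<comment> \<open>Passing from \<open>F\<close> to \<open>F'\<close> through \<open>e\<close>
    never meets \<open>X\<close>, which is drawn with edges other than \<open>e\<close>.\<close>
  then have dj: "?U \<inter> X = {}"
    using face_disjoint[OF F(1)] face_disjoint[OF F'(1)] open_edge_disjoint[OF e H] X by blast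
  have "?U \<subseteq> inside X" if "F \<subseteq> inside X \<or> F' \<subseteq> inside X"
    using that in_components_nonempty[OF F(1)] in_components_nonempty[OF F'(1)]
    by (intro connected_inside[OF con dj]) blast
  then show ?thesis by blast
qed

text \<open>Counting pairs of a face and a bordering edge gives
  \<open>3 * card \<Phi> \<le> 2 * card E\<close>. The cycles closed by the edges outside
  \<open>T\<close> give \<open>card E - card T \<le> card \<Phi>\<close>. Eliminating
  \<open>card \<Phi>\<close> yields the bound.\<close>

lemma card_edges_le_spanning_bridgeless:
  assumes bridgeless: "\<And>u v. {u, v} \<in> E \<Longrightarrow> (u, v) \<in> reach (E - {{u, v}})"
    and T: "T \<subseteq> E" and span: "\<And>u v. {u, v} \<in> E \<Longrightarrow> (u, v) \<in> reach T"
  shows "card E \<le> 3 * card T"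
proof -
  \<comment> \<open>Only faces that border an edge are counted: they are finitely many, at most two
    for each edge, and each of them has three bordering edges.\<close>
  define \<Phi> where "\<Phi> = {F \<in> components (- skeleton E). \<exists>e\<in>E. borders F e}"
  have cyc: "\<exists>c G. edge_cycle e c G \<and> G \<subseteq> skeleton (E - {e})" if e: "e \<in> E" for e
  proof -
    obtain u v where "e = {u, v}" using edgeE[OF \<open>e \<in> E\<close>] by metis
    then show ?thesis using cycle_through[OF e, of u v "E - {e}"] bridgeless[of u v] e
      by (metis Diff_iff Diff_subset insertI1)
  qed
  have two: "finite {F \<in> \<Phi>. borders F e} \<and> card {F \<in> \<Phi>. borders F e} \<le> 2" if e: "e \<in> E" for e
  proof -
    obtain c G where cG: "edge_cycle e c G" "G \<subseteq> skeleton (E - {e})" using cyc[OF e] by auto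
    obtain F F' where "{F \<in> components (- skeleton E). borders F e} = {F, F'}"
      using edge_faces[OF e cG] by metis
    moreover have "{F \<in> \<Phi>. borders F e} = {F \<in> components (- skeleton E). borders F e}"
      using e by (auto simp: \<Phi>_def)
    ultimately show ?thesis using card_insert_le_m1[of 2 "{F'}" F] by simp
  qed
  have "\<Phi> = (\<Union>e\<in>E. {F \<in> \<Phi>. borders F e})" by (auto simp: \<Phi>_def)
  then have fin: "finite \<Phi>" using finite_E two by (metis (no_types, lifting) finite_UN)
  have "3 \<le> card {e \<in> E. borders F e}" if "F \<in> \<Phi>" for F
    using that cyc three_edges_on_face unfolding \<Phi>_def by blast
  then have "3 * card \<Phi> \<le> (\<Sum>F\<in>\<Phi>. card {e \<in> E. borders F e})"
    using sum_bounded_below[of \<Phi> 3 "\<lambda>F. card {e \<in> E. borders F e}"] by simp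
  also have "\<dots> = (\<Sum>e\<in>E. card {F \<in> \<Phi>. borders F e})"
    by (rule sum_multicount_gen[OF fin finite_E]) simp
  also have "\<dots> \<le> 2 * card E"
    using sum_bounded_above[of E "\<lambda>e. card {F \<in> \<Phi>. borders F e}" 2] two by simp
  finally have count: "3 * card \<Phi> \<le> 2 * card E" .
  \<comment> \<open>The return part now stays in \<open>skeleton T\<close>, so the cycle of
    \<open>e\<close> avoids every other edge outside \<open>T\<close>.\<close>
  have "\<exists>c G. edge_cycle e c G \<and> G \<subseteq> skeleton T" if "e \<in> E - T" for e
  proof -
    have e: "e \<in> E" "e \<notin> T" using that by auto
    obtain u v where "e = {u, v}" using edgeE[OF e(1)] by metis
    then show ?thesis using cycle_through[OF e(1) _ T e(2), of u v] span[of u v] e by metis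
  qed
  then obtain c G where cG: "\<And>e. e \<in> E - T \<Longrightarrow> edge_cycle e (c e) (G e) \<and> G e \<subseteq> skeleton T"
    by metis
  \<comment> \<open>\<open>pat I F\<close> records which of the cycles indexed by \<open>I\<close>
    surround \<open>F\<close>. The number of patterns bounds the number of faces from below, and it
    grows with every cycle added.\<close>
  define pat where "pat I F = {i \<in> I. F \<subseteq> inside (path_image (c i))}" for I F
  have "card I \<le> card (pat I ` \<Phi>)" if "finite I" "I \<subseteq> E - T" for I
    using that
  proof (induction I rule: finite_induct)
    case (insert e I)
    then have e: "e \<in> E" "e \<notin> T" "e \<notin> I" and I: "I \<subseteq> E - T" by auto
    have "skeleton T \<subseteq> skeleton (E - {e})" using T e by (auto simp: skeleton_def)
    then have G: "edge_cycle e (c e) (G e)" "G e \<subseteq> skeleton (E - {e})" using cG[of e] e by auto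
    obtain F F' where F: "F \<subseteq> inside (path_image (c e))" "F' \<subseteq> outside (path_image (c e))"
      "{F \<in> components (- skeleton E). borders F e} = {F, F'}"
      by (rule edge_faces[OF e(1) G])
    have "F \<in> {F \<in> components (- skeleton E). borders F e}"
      "F' \<in> {F \<in> components (- skeleton E). borders F e}" unfolding F(3) by auto
    then have comp: "F \<in> components (- skeleton E)" "borders F e"
      "F' \<in> components (- skeleton E)" "borders F' e" by auto
    then have \<Phi>: "F \<in> \<Phi>" "F' \<in> \<Phi>" using e by (auto simp: \<Phi>_def)
    have "\<not> F' \<subseteq> inside (path_image (c e))"
      using F(2) in_components_nonempty[OF comp(3)] inside_Int_outside[of "path_image (c e)"] by blast
    then have neq: "pat (insert e I) F \<noteq> pat (insert e I) F'" using F(1) by (auto simp: pat_def)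
    have "F \<subseteq> inside (path_image (c i)) \<longleftrightarrow> F' \<subseteq> inside (path_image (c i))" if "i \<in> I" for i
    proof (rule inside_eq_across_edge[OF comp e(1)])
      have i: "i \<in> E - T" using that I by auto
      show "insert i T \<subseteq> E" using T i by auto
      show "e \<notin> insert i T" using e that by auto
      show "path_image (c i) \<subseteq> skeleton (insert i T)"
        using cG[OF i] unfolding skeleton_insert by (auto simp: edge_cycle_def)
    qed
    then have eq: "pat I F = pat I F'" by (auto simp: pat_def)
    \<comment> \<open>Forgetting \<open>e\<close> maps the patterns for \<open>insert e I\<close>
      onto those for \<open>I\<close>. The two faces at \<open>e\<close> have different patterns,
      since only one is inside the cycle of \<open>e\<close>, but this map identifies them; so the
      larger index set has strictly more patterns.\<close>
    have im: "pat I ` \<Phi> = (\<lambda>X. X \<inter> I) ` (pat (insert e I) ` \<Phi>)"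
      unfolding image_image by (rule image_cong) (auto simp: pat_def)
    have "pat (insert e I) F \<inter> I = pat (insert e I) F' \<inter> I"
      using eq by (auto simp: pat_def)
    then have "\<not> inj_on (\<lambda>X. X \<inter> I) (pat (insert e I) ` \<Phi>)"
      using neq \<Phi> by (auto simp: inj_on_def)
    then have "card (pat I ` \<Phi>) < card (pat (insert e I) ` \<Phi>)"
      unfolding im using fin by (intro card_image_less finite_imageI)
    then show ?case using insert.IH[OF I] insert.hyps by simp
  qed simp
  from this[of "E - T"] have "card (E - T) \<le> card (pat (E - T) ` \<Phi>)" using finite_E by simp
  also have "\<dots> \<le> card \<Phi>" by (rule card_image_le[OF fin])
  finally have "card E - card T \<le> card \<Phi>"
    using T finite_E by (simp add: card_Diff_subset finite_subset)
  then show ?thesis using count by linarith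
qed

end

text \<open>Induction on the number of edges, to get rid of bridges. A bridge belongs to every
  spanning \<open>T\<close>. Deleting it from both \<open>E\<close> and \<open>T\<close> lowers the
  left side by one and the right side by three, and the rest of \<open>T\<close> still spans the
  rest of \<open>E\<close>.\<close>

lemma card_edges_le_spanning:
  assumes "finite_simple_graph V E" "plane_drawing V E pt \<gamma>" "T \<subseteq> E"
    and "\<And>u v. {u, v} \<in> E \<Longrightarrow> (u, v) \<in> reach T"
  shows "card E \<le> 3 * card T"
  using assms
proof (induction "card E" arbitrary: E T)
  case 0
  interpret plane_graph V E pt \<gamma> using 0 by unfold_locales
  show ?case using 0 by simp
next
  case (Suc n)
  interpret plane_graph V E pt \<gamma> using Suc by unfold_locales
  show ?case
  proof (cases "\<forall>u v. {u, v} \<in> E \<longrightarrow> (u, v) \<in> reach (E - {{u, v}})")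
    case True
    then show ?thesis using card_edges_le_spanning_bridgeless[of T] Suc.prems by blast
  next
    case False
    then obtain u v where uv: "{u, v} \<in> E" "(u, v) \<notin> reach (E - {{u, v}})" by auto
    let ?e = "{u, v}" and ?S = "{w. (u, w) \<in> reach (E - {{u, v}})}"
    have eT: "?e \<in> T"
    proof (rule ccontr)
      assume "?e \<notin> T"
      then have "T \<subseteq> E - {?e}" using Suc.prems by auto
      then show False using Suc.prems(4)[OF uv(1)] uv(2) reach_mono by blast
    qed
    have uS: "u \<in> ?S" "v \<notin> ?S" using uv by auto
    have side: "x \<in> ?S \<longleftrightarrow> y \<in> ?S" if "{x, y} \<in> E - {?e}" for x y
    proof -
      have "{y, x} \<in> E - {?e}" using that by (simp add: insert_commute)
      then show ?thesis
        using that rtrancl_into_rtrancl[of u _ "{(x, y). {x, y} \<in> E - {?e}}"] by blast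
    qed
    have "card (E - {?e}) \<le> 3 * card (T - {?e})"
    proof (rule Suc.hyps(1))
      show "n = card (E - {?e})" using Suc.hyps(2) uv(1) by simp
      show "finite_simple_graph V (E - {?e})"
        using graph by (auto simp: finite_simple_graph_def)
      show "plane_drawing V (E - {?e}) pt \<gamma>" using drawing by (auto simp: plane_drawing_def)
      show "T - {?e} \<subseteq> E - {?e}" using Suc.prems by auto
    next
      fix x y assume xy: "{x, y} \<in> E - {?e}"
      \<comment> \<open>Contract the far side of the bridge to its near end.\<close>
      define \<phi> where "\<phi> w = (if w \<in> ?S \<longleftrightarrow> x \<in> ?S then w else if x \<in> ?S then u else v)" for w
      have "(x, \<phi> w) \<in> reach (T - {?e})" if "(x, w) \<in> reach T" for w
        using that
      proof (induction rule: rtrancl_induct)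
        case base
        then show ?case by (simp add: \<phi>_def)
      next
        case (step y z)
        then have yz: "{y, z} \<in> T" by simp
        show ?case
        proof (cases "{y, z} = ?e")
          case True
          then have "\<phi> y = \<phi> z" using uS by (auto simp: \<phi>_def doubleton_eq_iff)
          then show ?thesis using step.IH by simp
        next
          case False
          then have "y \<in> ?S \<longleftrightarrow> z \<in> ?S" using side[of y z] yz Suc.prems by blast
          then have "\<phi> y = \<phi> z \<or> (\<phi> y = y \<and> \<phi> z = z)" by (auto simp: \<phi>_def)
          then show ?thesis
          proof
            assume "\<phi> y = \<phi> z"
            then show ?thesis using step.IH by simp
          next
            assume \<phi>: "\<phi> y = y \<and> \<phi> z = z"
            have "(y, z) \<in> {(x, y). {x, y} \<in> T - {?e}}" using yz False by simp
            from rtrancl_into_rtrancl[OF _ this, of x] show ?thesis using step.IH \<phi> by simp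
          qed
        qed
      qed
      moreover have "(x, y) \<in> reach T" using Suc.prems xy by blast
      moreover have "\<phi> y = y" using side[OF xy] by (simp add: \<phi>_def)
      ultimately show "(x, y) \<in> reach (T - {?e})" by metis
    qed
    moreover have "card E = Suc (card (E - {?e}))" "card T = Suc (card (T - {?e}))"
      using uv(1) eT finite_E Suc.prems(3) by (metis card_Suc_Diff1 finite_subset)+
    ultimately show ?thesis by simp
  qed
qed

text \<open>\<open>T\<close> has as many edges as possible subject to the inequality that a forest
  satisfies between its edges and its classes. If an edge of \<open>E\<close> still joined two
  classes of \<open>T\<close>, adding it would merge them and preserve the inequality, against
  maximality.\<close>

lemma spanning_edges:
  assumes "finite V" "E \<subseteq> nsets V 2"
  obtains T where "T \<subseteq> E" "card T \<le> card V" "\<And>u v. {u, v} \<in> E \<Longrightarrow> (u, v) \<in> reach T"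
proof -
  have fE: "finite E" using assms by (auto simp: nsets_def intro: finite_subset[of E "Pow V"])
  let ?cl = "\<lambda>T x. {y \<in> V. (x, y) \<in> reach T}"
  define P where "P T \<longleftrightarrow> T \<subseteq> E \<and> card T + card (?cl T ` V) \<le> card V" for T
  have "P {}" using card_image_le[OF assms(1)] by (simp add: P_def)
  moreover have "\<forall>T. P T \<longrightarrow> card T < Suc (card E)"
    using card_mono[OF fE] by (simp add: P_def less_Suc_eq_le)
  ultimately have "\<exists>T. P T \<and> (\<forall>T'. P T' \<longrightarrow> card T' \<le> card T)"
    by (rule ex_has_greatest_nat)
  then obtain T where PT: "P T" and max: "\<And>T'. P T' \<Longrightarrow> card T' \<le> card T" by metis
  have T: "T \<subseteq> E" "card T + card (?cl T ` V) \<le> card V" using PT by (auto simp: P_def)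
  have "(u, v) \<in> reach T" if uv: "{u, v} \<in> E" for u v
  proof (rule ccontr)
    assume n: "(u, v) \<notin> reach T"
    let ?T = "insert {u, v} T"
    have V: "u \<in> V" "v \<in> V" using uv assms by (auto simp: nsets_def)
    have "{u, v} \<notin> T" using n by auto
    have sub: "reach T \<subseteq> reach ?T" by (rule reach_mono) auto
    have cl_eq: "?cl ?T y = ?cl ?T x" if "(x, y) \<in> reach ?T" for x y
    proof -
      have "(y, x) \<in> reach ?T" using that sym_reach by (metis symD)
      then show ?thesis using that by (auto intro: rtrancl_trans)
    qed
    have "\<Union>(?cl ?T ` ?cl T x) = ?cl ?T x" if "x \<in> V" for x
    proof -
      have "?cl ?T y = ?cl ?T x" if "y \<in> ?cl T x" for y using that sub cl_eq by blast
      moreover have "x \<in> ?cl T x" using that by simp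
      ultimately show ?thesis by blast
    qed
    \<comment> \<open>Each old class is sent to the new class containing it. This map is onto and
      identifies the classes of \<open>u\<close> and \<open>v\<close>.\<close>
    then have im: "?cl ?T ` V = (\<lambda>X. \<Union>(?cl ?T ` X)) ` (?cl T ` V)"
      unfolding image_image by (intro image_cong) auto
    have "(u, v) \<in> reach ?T" by (rule r_into_rtrancl) simp
    then have "\<Union>(?cl ?T ` ?cl T u) = \<Union>(?cl ?T ` ?cl T v)"
      using cl_eq[of u v] V \<open>\<And>x. x \<in> V \<Longrightarrow> \<Union>(?cl ?T ` ?cl T x) = ?cl ?T x\<close> by simp
    moreover have "?cl T u \<noteq> ?cl T v" using n V by blast
    ultimately have "\<not> inj_on (\<lambda>X. \<Union>(?cl ?T ` X)) (?cl T ` V)"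
      using V unfolding inj_on_def by blast
    then have "card (?cl ?T ` V) < card (?cl T ` V)"
      unfolding im using assms(1) by (intro card_image_less finite_imageI)
    moreover have "card ?T = Suc (card T)"
      using \<open>{u, v} \<notin> T\<close> T(1) fE finite_subset by (metis card_insert_disjoint)
    ultimately have "P ?T" using T uv by (simp add: P_def)
    from max[OF this] show False using \<open>card ?T = Suc (card T)\<close> by simp
  qed
  then show thesis using that[of T] T by auto
qed

lemma planar_graph_card_edges:
  assumes "finite_simple_graph V E" "planar_graph V E"
  shows "card E \<le> 3 * card V"
proof -
  obtain pt \<gamma> where d: "plane_drawing V E pt \<gamma>" using assms(2) by (auto simp: planar_graph_def)
  have VE: "finite V" "E \<subseteq> nsets V 2" using assms(1) by (auto simp: finite_simple_graph_def)
  obtain T where T: "T \<subseteq> E" "card T \<le> card V" "\<And>u v. {u, v} \<in> E \<Longrightarrow> (u, v) \<in> reach T"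
    by (rule spanning_edges[OF VE]) blast
  show ?thesis using card_edges_le_spanning[OF assms(1) d T(1,3)] T(2) by simp
qed

text \<open>Lets the edge bound be applied to every vertex subset, as the layer-cake argument
  requires.\<close>

lemma planar_graph_induced:
  assumes "planar_graph V E" "S \<subseteq> V"
  shows "planar_graph S {e \<in> E. e \<subseteq> S}"
proof -
  obtain pt \<gamma> where d: "plane_drawing V E pt \<gamma>" using assms(1) by (auto simp: planar_graph_def)
  then have ends: "path_image (\<gamma> e) \<inter> pt ` V = pt ` e" if "e \<in> E" for e
    using that by (simp add: plane_drawing_def)
  have "path_image (\<gamma> e) \<inter> pt ` S = pt ` e" if "e \<in> E" "e \<subseteq> S" for e
    using ends[OF that(1)] that(2) assms(2) by blast
  then have "plane_drawing S {e \<in> E. e \<subseteq> S} pt \<gamma>"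
    using d inj_on_subset[OF _ assms(2), of pt] by (simp add: plane_drawing_def)
  then show ?thesis by (auto simp: planar_graph_def)
qed

section \<open>Eigenvalues of reversible kernels\<close>

lemma eigenvector_sum:
  fixes A :: "'a :: field mat"
  assumes A: "A \<in> carrier_mat n n" and root: "poly (char_poly A) a = 0"
  obtains w where "\<And>i. i < n \<Longrightarrow> (\<Sum>j<n. A $$ (i, j) * w j) = a * w i" "\<exists>i<n. w i \<noteq> 0"
proof -
  obtain v where v: "eigenvector A v a"
    using root eigenvalue_root_char_poly[OF A] by (auto simp: eigenvalue_def)
  then have vn: "v \<in> carrier_vec n" "v \<noteq> 0\<^sub>v n" and Av: "A *\<^sub>v v = a \<cdot>\<^sub>v v"
    using A by (auto simp: eigenvector_def)
  have "(\<Sum>j<n. A $$ (i, j) * vec_index v j) = a * vec_index v i" if i: "i < n" for i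
  proof -
    have "vec_index (A *\<^sub>v v) i = (\<Sum>j<n. A $$ (i, j) * vec_index v j)"
      using i A vn(1) by (simp add: scalar_prod_def atLeast0LessThan)
    then show ?thesis using Av i vn(1) by simp
  qed
  moreover have "\<exists>i<n. vec_index v i \<noteq> 0"
  proof (rule ccontr)
    assume "\<not> ?thesis"
    then have "v = 0\<^sub>v n" using vn(1) by (intro eq_vecI) auto
    then show False using vn(2) by simp
  qed
  ultimately show thesis using that[of "\<lambda>j. vec_index v j"] by blast
qed

lemma weighted_sum_squares_pos:
  fixes m g :: "nat \<Rightarrow> real"
  assumes "\<And>i. i < n \<Longrightarrow> 0 < m i" "\<exists>i<n. g i \<noteq> 0"
  shows "0 < (\<Sum>i<n. m i * (g i)\<^sup>2)"
proof -
  obtain i where "i < n" "g i \<noteq> 0" using assms(2) by auto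
  then show ?thesis using assms(1)
    by (intro sum_pos2[of _ i]) (auto intro!: mult_nonneg_nonneg intro: less_imp_le)
qed

text \<open>\<open>eigenvalues_desc\<close> collects only real roots; splitting over the reals makes
  the list as long as the state space, so that its indices have the intended meaning. The complex
  roots are real because reversibility makes the weighted Hermitian form \<open>S\<close> equal to
  its conjugate.\<close>

lemma char_poly_reversible_splits:
  fixes M :: "real mat"
  assumes M: "M \<in> carrier_mat n n" and m: "\<And>i. i < n \<Longrightarrow> 0 < m i"
    and rev: "\<And>i j. i < n \<Longrightarrow> j < n \<Longrightarrow> m i * M $$ (i, j) = m j * M $$ (j, i)"
  obtains es where "char_poly M = (\<Prod>e\<leftarrow>es. [:- e, 1:])" "length es = n"
proof -
  define A where "A = map_mat complex_of_real M"
  have A: "A \<in> carrier_mat n n" and Aij: "\<And>i j. i < n \<Longrightarrow> j < n \<Longrightarrow> A $$ (i, j) = of_real (M $$ (i, j))"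
    using M by (auto simp: A_def)
  obtain as where as: "char_poly A = (\<Prod>a\<leftarrow>as. [:- a, 1:])" "length as = n"
    using char_poly_factorized[OF A] by auto
  have real: "complex_of_real (Re a) = a" if a: "a \<in> set as" for a
  proof -
    have "poly (char_poly A) a = 0"
      unfolding as(1) using a by (simp add: poly_prod_list prod_list_zero_iff image_iff)
    from eigenvector_sum[OF A this] obtain w
      where w: "\<And>i. i < n \<Longrightarrow> (\<Sum>j<n. A $$ (i, j) * w j) = a * w i" "\<exists>i<n. w i \<noteq> 0"
      by blast
    define S where "S = (\<Sum>i<n. \<Sum>j<n. of_real (m i * M $$ (i, j)) * (cnj (w i) * w j))"
    have "S = (\<Sum>i<n. of_real (m i) * cnj (w i) * (\<Sum>j<n. A $$ (i, j) * w j))"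
      unfolding S_def sum_distrib_left by (intro sum.cong refl) (simp add: Aij)
    also have "\<dots> = (\<Sum>i<n. of_real (m i) * cnj (w i) * (a * w i))"
      by (intro sum.cong refl) (simp add: w(1))
    also have "\<dots> = a * of_real (\<Sum>i<n. m i * (cmod (w i))\<^sup>2)"
      unfolding of_real_sum sum_distrib_left
      by (intro sum.cong refl) (simp only: of_real_mult complex_norm_square mult_ac)
    finally have S: "S = a * of_real (\<Sum>i<n. m i * (cmod (w i))\<^sup>2)" .
    have "cnj S = (\<Sum>i<n. \<Sum>j<n. of_real (m j * M $$ (j, i)) * (cnj (w j) * w i))"
      unfolding S_def cnj_sum by (intro sum.cong refl) (simp add: rev[symmetric] flip: of_real_mult)
    also have "\<dots> = S" unfolding S_def by (rule sum.swap)
    finally have "cnj a = a"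
      using S weighted_sum_squares_pos[of n m "\<lambda>i. cmod (w i)"] m w(2) by (auto simp: complex_eq_iff)
    then show ?thesis by (simp add: complex_eq_iff)
  qed
  interpret map_poly_of_real: map_poly_inj_idom_hom complex_of_real ..
  have "map_poly complex_of_real (char_poly M) = char_poly A"
    unfolding A_def by (rule of_real_hom.char_poly_hom[OF M, symmetric])
  also have "\<dots> = (\<Prod>e\<leftarrow>map Re as. [:- complex_of_real e, 1:])"
    unfolding as(1) using real by (simp add: o_def cong: map_cong)
  also have "\<dots> = map_poly complex_of_real (\<Prod>e\<leftarrow>map Re as. [:- e, 1:])"
    by (simp add: map_poly_of_real.hom_prod_list o_def)
  finally have "char_poly M = (\<Prod>e\<leftarrow>map Re as. [:- e, 1:])" by simp
  then show thesis using that[of "map Re as"] as(2) by simp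
qed

text \<open>Multiplicities are algebraic and \<open>es ! 0\<close> may equal \<open>es ! 1\<close>,
  so two independent eigenvectors are not immediate. The first two columns of a Schur basis span an
  invariant plane; Gram-Schmidt in the weighted inner product makes the second orthogonal to the
  first, and self-adjointness removes the coupling.\<close>

lemma two_eigenvectors:
  fixes M :: "real mat"
  assumes M: "M \<in> carrier_mat n n" and n: "2 \<le> n" and m: "\<And>i. i < n \<Longrightarrow> 0 < m i"
    and rev: "\<And>i j. i < n \<Longrightarrow> j < n \<Longrightarrow> m i * M $$ (i, j) = m j * M $$ (j, i)"
    and es: "char_poly M = (\<Prod>e\<leftarrow>es. [:- e, 1:])"
  obtains f g where "\<And>i. i < n \<Longrightarrow> (\<Sum>j<n. M $$ (i, j) * f j) = es ! 0 * f i"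
    "\<And>i. i < n \<Longrightarrow> (\<Sum>j<n. M $$ (i, j) * g j) = es ! 1 * g i"
    "(\<Sum>i<n. m i * f i * g i) = 0" "\<exists>i<n. f i \<noteq> 0" "\<exists>i<n. g i \<noteq> 0"
proof -
  obtain B P Q where "schur_decomposition M es = (B, P, Q)" by (metis prod_cases3)
  from schur_decomposition[OF M es this]
  have sim: "similar_mat_wit M B P Q" and ut: "upper_triangular B" and diag: "diag_mat B = es" by auto
  note S = similar_mat_witD2[OF M sim]
  have B: "B $$ (i, i) = es ! i" if "i < n" for i
    using S(5) that unfolding diag[symmetric] diag_mat_def by simp
  have B0: "B $$ (i, j) = 0" if "j < i" "i < n" for i j
    using ut that S(5) by (auto simp: upper_triangular_def)
  have "M * P = P * B * (Q * P)" unfolding S(3) using S by (simp add: assoc_mult_mat[of _ n n _ n _ n])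
  then have MP: "M * P = P * B" using S by simp
  have col: "(\<Sum>j<n. M $$ (i, j) * P $$ (j, k)) = (\<Sum>j<n. P $$ (i, j) * B $$ (j, k))"
    if "i < n" "k < n" for i k
    using arg_cong[OF MP, of "\<lambda>A. A $$ (i, k)"] S that by (simp add: scalar_prod_def atLeast0LessThan)
  have QP: "(\<Sum>j<n. Q $$ (i, j) * P $$ (j, k)) = (if i = k then 1 else 0)" if "i < n" "k < n" for i k
    using arg_cong[OF S(2), of "\<lambda>A. A $$ (i, k)"] S(6,7) that by (simp add: scalar_prod_def atLeast0LessThan)
  define f where "f j = P $$ (j, 0)" for j
  define p where "p j = P $$ (j, 1)" for j
  let ?e0 = "es ! 0" and ?e1 = "es ! 1" and ?b = "B $$ (0, 1)"
  have f: "(\<Sum>j<n. M $$ (i, j) * f j) = ?e0 * f i" if "i < n" for i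
  proof -
    have "(\<Sum>j<n. P $$ (i, j) * B $$ (j, 0)) = (\<Sum>j\<in>{0}. P $$ (i, j) * B $$ (j, 0))"
      using n by (intro sum.mono_neutral_right) (auto simp: B0)
    then show ?thesis using col[OF that, of 0] n B[of 0] by (simp add: f_def)
  qed
  have p: "(\<Sum>j<n. M $$ (i, j) * p j) = ?e1 * p i + ?b * f i" if "i < n" for i
  proof -
    have "(\<Sum>j<n. P $$ (i, j) * B $$ (j, 1)) = (\<Sum>j\<in>{0, 1}. P $$ (i, j) * B $$ (j, 1))"
      using n by (intro sum.mono_neutral_right) (auto simp: B0)
    then show ?thesis using col[OF that, of 1] n B[of 1] by (simp add: f_def p_def)
  qed
  have f0: "\<exists>i<n. f i \<noteq> 0"
  proof (rule ccontr)
    assume "\<not> ?thesis"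
    then have "(\<Sum>j<n. Q $$ (0, j) * f j) = 0" by (intro sum.neutral) auto
    then show False using QP[of 0 0] n by (simp add: f_def)
  qed
  have ff: "0 < (\<Sum>i<n. m i * (f i)\<^sup>2)" by (rule weighted_sum_squares_pos[OF m f0])
  define t where "t = (\<Sum>i<n. m i * f i * p i) / (\<Sum>i<n. m i * (f i)\<^sup>2)"
  define g where "g j = p j - t * f j" for j
  have "(\<Sum>i<n. m i * f i * g i) = (\<Sum>i<n. m i * f i * p i) - t * (\<Sum>i<n. m i * (f i)\<^sup>2)"
    by (simp add: g_def sum_subtractf sum_distrib_left power2_eq_square algebra_simps)
  then have fg: "(\<Sum>i<n. m i * f i * g i) = 0" using ff by (simp add: t_def)
  \<comment> \<open>\<open>d\<close> is the remaining coupling of \<open>g\<close> to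
    \<open>f\<close>. Pairing the image of \<open>g\<close> with \<open>f\<close> and using
    reversibility shows that \<open>d\<close> times the squared norm of \<open>f\<close> is
    zero.\<close>
  define d where "d = ?e1 * t + ?b - t * ?e0"
  have g: "(\<Sum>j<n. M $$ (i, j) * g j) = ?e1 * g i + d * f i" if "i < n" for i
  proof -
    have "(\<Sum>j<n. M $$ (i, j) * g j) = (\<Sum>j<n. M $$ (i, j) * p j) - t * (\<Sum>j<n. M $$ (i, j) * f j)"
      by (simp add: g_def sum_subtractf sum_distrib_left algebra_simps)
    then show ?thesis using f[OF that] p[OF that] by (simp add: g_def d_def algebra_simps)
  qed
  have "(\<Sum>i<n. m i * f i * (\<Sum>j<n. M $$ (i, j) * g j)) = (\<Sum>i<n. \<Sum>j<n. m i * M $$ (i, j) * f i * g j)"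
    by (simp add: sum_distrib_left mult_ac)
  also have "\<dots> = (\<Sum>i<n. \<Sum>j<n. m j * M $$ (j, i) * f i * g j)"
    using rev by (intro sum.cong refl) auto
  also have "\<dots> = (\<Sum>j<n. \<Sum>i<n. m j * M $$ (j, i) * f i * g j)" by (rule sum.swap)
  also have "\<dots> = (\<Sum>j<n. m j * g j * (\<Sum>i<n. M $$ (j, i) * f i))"
    by (simp add: sum_distrib_left mult_ac)
  also have "\<dots> = (\<Sum>j<n. m j * g j * (?e0 * f j))" by (intro sum.cong refl) (simp add: f)
  also have "\<dots> = ?e0 * (\<Sum>j<n. m j * f j * g j)" by (simp add: sum_distrib_left mult_ac)
  finally have "(\<Sum>i<n. m i * f i * (\<Sum>j<n. M $$ (i, j) * g j)) = 0" using fg by simp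
  moreover have "(\<Sum>i<n. m i * f i * (\<Sum>j<n. M $$ (i, j) * g j)) =
      (\<Sum>i<n. m i * f i * (?e1 * g i + d * f i))"
    by (intro sum.cong refl) (simp add: g)
  moreover have "\<dots> = ?e1 * (\<Sum>i<n. m i * f i * g i) + d * (\<Sum>i<n. m i * (f i)\<^sup>2)"
    by (simp add: sum.distrib sum_distrib_left power2_eq_square algebra_simps)
  ultimately have "d = 0" using fg ff by simp
  \<comment> \<open>Row 1 of \<open>Q\<close>, the inverse of \<open>P\<close>, annihilates
    \<open>f\<close> and gives 1 on \<open>p\<close>, hence also 1 on \<open>g\<close>.\<close>
  have g0: "\<exists>i<n. g i \<noteq> 0"
  proof (rule ccontr)
    assume "\<not> ?thesis"
    then have "(\<Sum>j<n. Q $$ (1, j) * g j) = 0" by (intro sum.neutral) auto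
    moreover have "(\<Sum>j<n. Q $$ (1, j) * g j) =
        (\<Sum>j<n. Q $$ (1, j) * p j) - t * (\<Sum>j<n. Q $$ (1, j) * f j)"
      by (simp add: g_def sum_subtractf sum_distrib_left algebra_simps)
    ultimately show False using QP[of 1 0] QP[of 1 1] n by (simp add: f_def p_def)
  qed
  show thesis by (rule that[OF f _ fg f0 g0]) (use g \<open>d = 0\<close> in simp_all)
qed

text \<open>Courant-Fischer in dimension two: the span of \<open>f\<close> and \<open>g\<close>
  contains a nonzero vector of mean zero, and on this span the Rayleigh quotient is at least
  \<open>es ! 1\<close>. This avoids identifying the top eigenvector with the constants.\<close>

lemma second_eigenvalue_le:
  fixes M :: "real mat"
  assumes M: "M \<in> carrier_mat n n" and n: "2 \<le> n" and m: "\<And>i. i < n \<Longrightarrow> 0 < m i"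
    and rev: "\<And>i j. i < n \<Longrightarrow> j < n \<Longrightarrow> m i * M $$ (i, j) = m j * M $$ (j, i)"
    and es: "char_poly M = (\<Prod>e\<leftarrow>es. [:- e, 1:])" and desc: "es ! 1 \<le> es ! 0"
    and poincare: "\<And>h. (\<Sum>i<n. m i * h i) = 0 \<Longrightarrow>
      (\<Sum>i<n. m i * h i * (\<Sum>j<n. M $$ (i, j) * h j)) \<le> r * (\<Sum>i<n. m i * (h i)\<^sup>2)"
  shows "es ! 1 \<le> r"
proof -
  from two_eigenvectors[OF M n m rev es] obtain f g
    where f: "\<And>i. i < n \<Longrightarrow> (\<Sum>j<n. M $$ (i, j) * f j) = es ! 0 * f i"
    and g: "\<And>i. i < n \<Longrightarrow> (\<Sum>j<n. M $$ (i, j) * g j) = es ! 1 * g i"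
    and fg: "(\<Sum>i<n. m i * f i * g i) = 0" and nz: "\<exists>i<n. f i \<noteq> 0" "\<exists>i<n. g i \<noteq> 0"
    by blast
  have pos: "0 < (\<Sum>i<n. m i * (f i)\<^sup>2)" "0 < (\<Sum>i<n. m i * (g i)\<^sup>2)"
    using weighted_sum_squares_pos[of n m] m nz by blast+
  let ?F = "\<Sum>i<n. m i * (f i)\<^sup>2" and ?G = "\<Sum>i<n. m i * (g i)\<^sup>2"
  \<comment> \<open>If \<open>f\<close> has mean zero it is used as it stands; otherwise the two
    means are cancelled against each other, and \<open>b\<close> is nonzero.\<close>
  define a where "a = (if (\<Sum>i<n. m i * f i) = 0 then 1 else (\<Sum>i<n. m i * g i))"
  define b where "b = (if (\<Sum>i<n. m i * f i) = 0 then 0 else - (\<Sum>i<n. m i * f i))"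
  define h where "h i = a * f i + b * g i" for i
  have ab: "a \<noteq> 0 \<or> b \<noteq> 0" by (auto simp: a_def b_def)
  have "(\<Sum>i<n. m i * h i) = a * (\<Sum>i<n. m i * f i) + b * (\<Sum>i<n. m i * g i)"
    by (simp add: h_def sum.distrib sum_distrib_left algebra_simps)
  then have "(\<Sum>i<n. m i * h i) = 0" by (auto simp: a_def b_def)
  note poincare[OF this]
  moreover have "(\<Sum>i<n. m i * (h i)\<^sup>2) = a\<^sup>2 * ?F + b\<^sup>2 * ?G + 2 * a * b * (\<Sum>i<n. m i * f i * g i)"
    by (simp add: h_def sum.distrib sum_distrib_left algebra_simps power2_eq_square)
  moreover have "(\<Sum>i<n. m i * h i * (\<Sum>j<n. M $$ (i, j) * h j)) =
      (\<Sum>i<n. m i * h i * (a * (es ! 0 * f i) + b * (es ! 1 * g i)))"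
  proof (intro sum.cong refl)
    fix i assume "i \<in> {..<n}"
    then have i: "i < n" by simp
    have "(\<Sum>j<n. M $$ (i, j) * h j) = a * (\<Sum>j<n. M $$ (i, j) * f j) + b * (\<Sum>j<n. M $$ (i, j) * g j)"
      by (simp add: h_def sum.distrib sum_distrib_left algebra_simps)
    then show "m i * h i * (\<Sum>j<n. M $$ (i, j) * h j) = m i * h i * (a * (es ! 0 * f i) + b * (es ! 1 * g i))"
      using f[OF i] g[OF i] by simp
  qed
  moreover have "\<dots> = es ! 0 * (a\<^sup>2 * ?F) + es ! 1 * (b\<^sup>2 * ?G) +
      (es ! 0 + es ! 1) * (a * b) * (\<Sum>i<n. m i * f i * g i)"
    by (simp add: h_def sum.distrib sum_distrib_left algebra_simps power2_eq_square)
  ultimately have "es ! 0 * (a\<^sup>2 * ?F) + es ! 1 * (b\<^sup>2 * ?G) \<le> r * (a\<^sup>2 * ?F + b\<^sup>2 * ?G)"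
    unfolding fg by simp
  moreover have "es ! 1 * (a\<^sup>2 * ?F) \<le> es ! 0 * (a\<^sup>2 * ?F)"
    using desc pos by (intro mult_right_mono) auto
  ultimately have "es ! 1 * (a\<^sup>2 * ?F + b\<^sup>2 * ?G) \<le> r * (a\<^sup>2 * ?F + b\<^sup>2 * ?G)"
    by (simp add: algebra_simps)
  moreover have "0 < a\<^sup>2 * ?F + b\<^sup>2 * ?G"
  proof (cases "a = 0")
    case True
    then show ?thesis using ab pos(2) by simp
  next
    case False
    then have "0 < a\<^sup>2 * ?F" using pos(1) by simp
    moreover have "0 \<le> b\<^sup>2 * ?G" using pos(2) by simp
    ultimately show ?thesis by linarith
  qed
  ultimately show ?thesis by simp
qed

text \<open>Semidefiniteness settles the absolute value in \<open>spectral_gap\<close>: the smallest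
  eigenvalue is nonnegative, so its modulus does not exceed \<open>es ! 1\<close>, which the
  Poincare inequality controls.\<close>

lemma spectral_gap_ge:
  fixes K :: "'s \<Rightarrow> 's \<Rightarrow> real"
  assumes fin: "finite \<Omega>" and card: "2 \<le> card \<Omega>" and pos: "\<And>x. x \<in> \<Omega> \<Longrightarrow> 0 < \<mu> x"
    and rev: "reversible \<Omega> K \<mu>"
    and psd: "\<And>f. 0 \<le> (\<Sum>x\<in>\<Omega>. \<mu> x * f x * (\<Sum>y\<in>\<Omega>. K x y * f y))"
    and poincare: "\<And>f. (\<Sum>x\<in>\<Omega>. \<mu> x * f x) = 0 \<Longrightarrow>
      (\<Sum>x\<in>\<Omega>. \<mu> x * f x * (\<Sum>y\<in>\<Omega>. K x y * f y)) \<le> r * (\<Sum>x\<in>\<Omega>. \<mu> x * (f x)\<^sup>2)"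
  shows "1 - r \<le> spectral_gap \<Omega> K"
proof -
  define n where "n = card \<Omega>"
  define s where "s = (SOME s :: nat \<Rightarrow> 's. bij_betw s {..<card \<Omega>} \<Omega>)"
  define M where "M = mat n n (\<lambda>(i, j). K (s i) (s j))"
  define es where "es = eigenvalues_desc \<Omega> K"
  have "\<exists>s. bij_betw s {..<card \<Omega>} \<Omega>"
    using ex_bij_betw_nat_finite[OF fin] by (simp add: atLeast0LessThan)
  then have s: "bij_betw s {..<n} \<Omega>" unfolding s_def n_def by (rule someI_ex)
  have s_in: "s i \<in> \<Omega>" if "i < n" for i using s that by (auto dest: bij_betwE)
  have sum_s: "(\<Sum>i<n. F (s i)) = (\<Sum>x\<in>\<Omega>. F x)" for F :: "'s \<Rightarrow> real"
    by (rule sum.reindex_bij_betw[OF s])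
  define t where "t = the_inv_into {..<n} s"
  have t: "t (s i) = i" if "i < n" for i
    unfolding t_def using s that by (intro the_inv_into_f_f) (auto simp: bij_betw_def)
  have sum_M: "(\<Sum>i<n. \<mu> (s i) * h i * (\<Sum>j<n. M $$ (i, j) * h j)) =
      (\<Sum>x\<in>\<Omega>. \<mu> x * h (t x) * (\<Sum>y\<in>\<Omega>. K x y * h (t y)))" for h
    unfolding sum_s[symmetric] by (intro sum.cong refl) (simp add: M_def t)
  have M: "M \<in> carrier_mat n n" and n: "2 \<le> n" using card by (auto simp: M_def n_def)
  have m: "0 < \<mu> (s i)" if "i < n" for i using pos s_in[OF that] .
  have revM: "\<mu> (s i) * M $$ (i, j) = \<mu> (s j) * M $$ (j, i)" if "i < n" "j < n" for i j
    using rev s_in[OF that(1)] s_in[OF that(2)] that by (simp add: M_def reversible_def)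
  obtain ds where ds: "char_poly M = (\<Prod>e\<leftarrow>ds. [:- e, 1:])" "length ds = n"
    by (rule char_poly_reversible_splits[OF M m revM])
  have "proots (char_poly M) = mset ds"
    unfolding ds(1) by (induction ds) (simp_all add: proots_mult prod_list_zero_iff image_iff del: mult_pCons_left)
  moreover have "kernel_matrix \<Omega> K = M"
    by (simp add: kernel_matrix_def Let_def M_def s_def n_def)
  ultimately have es_ds: "es = rev (sort ds)"
    by (simp add: es_def eigenvalues_desc_def sorted_list_of_multiset_mset)
  then have "mset es = mset ds" by simp
  then have "(\<Prod>e\<leftarrow>ds. [:- e, 1:]) = (\<Prod>e\<leftarrow>es. [:- e, 1:])"
    by (metis mset_map prod_mset_prod_list)
  then have es: "char_poly M = (\<Prod>e\<leftarrow>es. [:- e, 1:])" using ds by simp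
  have len: "length es = n" using es_ds ds by simp
  have desc: "es ! j \<le> es ! i" if "i \<le> j" "j < n" for i j
  proof -
    have "es ! k = sort ds ! (n - Suc k)" if "k < n" for k
      using that ds(2) by (simp add: es_ds rev_nth)
    then show ?thesis using that ds(2) by (auto intro!: sorted_nth_mono)
  qed
  have "es ! 1 \<le> r"
  proof (rule second_eigenvalue_le[OF M n m revM es])
    show "es ! 1 \<le> es ! 0" using n by (intro desc) auto
    fix h :: "nat \<Rightarrow> real" assume h0: "(\<Sum>i<n. \<mu> (s i) * h i) = 0"
    have "(\<Sum>i<n. \<mu> (s i) * F (h i)) = (\<Sum>x\<in>\<Omega>. \<mu> x * F (h (t x)))" for F :: "real \<Rightarrow> real"
      unfolding sum_s[symmetric] by (intro sum.cong refl) (simp add: t)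
    from this[of "\<lambda>x. x"] this[of "\<lambda>x. x\<^sup>2"]
    show "(\<Sum>i<n. \<mu> (s i) * h i * (\<Sum>j<n. M $$ (i, j) * h j)) \<le> r * (\<Sum>i<n. \<mu> (s i) * (h i)\<^sup>2)"
      unfolding sum_M using poincare[of "\<lambda>x. h (t x)"] h0 by simp
  qed auto
  moreover have "0 \<le> es ! (n - 1)"
  proof -
    have "es ! (n - 1) \<in> set es" using len n by simp
    then have "poly (char_poly M) (es ! (n - 1)) = 0"
      unfolding es by (simp add: poly_prod_list prod_list_zero_iff image_iff)
    from eigenvector_sum[OF M this] obtain h
      where h: "\<And>i. i < n \<Longrightarrow> (\<Sum>j<n. M $$ (i, j) * h j) = es ! (n - 1) * h i" "\<exists>i<n. h i \<noteq> 0"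
      by blast
    have "0 \<le> (\<Sum>i<n. \<mu> (s i) * h i * (\<Sum>j<n. M $$ (i, j) * h j))"
      unfolding sum_M by (rule psd)
    also have "\<dots> = (\<Sum>i<n. \<mu> (s i) * h i * (es ! (n - 1) * h i))"
      by (intro sum.cong refl) (simp add: h(1))
    also have "\<dots> = es ! (n - 1) * (\<Sum>i<n. \<mu> (s i) * (h i)\<^sup>2)"
      by (simp add: sum_distrib_left power2_eq_square mult_ac)
    finally show ?thesis
      using weighted_sum_squares_pos[of n "\<lambda>i. \<mu> (s i)" h] m h(2) by (simp add: zero_le_mult_iff)
  qed
  moreover have "es ! (n - 1) \<le> es ! 1" using n by (intro desc) auto
  ultimately show ?thesis by (simp add: spectral_gap_def Let_def es_def[symmetric] n_def[symmetric])
qed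

section \<open>Swendsen-Wang and heat-bath dynamics\<close>

lemma sum_Pow_power:
  fixes x :: real
  assumes "finite S"
  shows "(\<Sum>A\<in>Pow S. x ^ card A) = (1 + x) ^ card S"
  using prod_add[OF assms, of "\<lambda>_. x" "\<lambda>_. 1"] by (simp add: add.commute)

locale potts =
  fixes V :: "'v set" and E :: "'v set set" and \<beta> :: real and q :: nat
  assumes graph: "finite_simple_graph V E" and q_pos: "1 \<le> q" and \<beta>_nonneg: "0 \<le> \<beta>"
begin

abbreviation configs ("\<Omega>") where "\<Omega> \<equiv> potts_configs V q"

definition weight :: "('v \<Rightarrow> nat) \<Rightarrow> real" where
  "weight \<sigma> = exp (\<beta> * real (card (mono_edges E \<sigma>)))"

definition compatible :: "'v set set \<Rightarrow> ('v \<Rightarrow> nat) set" where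
  "compatible A = {\<sigma> \<in> \<Omega>. A \<subseteq> mono_edges E \<sigma>}"

text \<open>The inner product is left unnormalised; the spectral estimates are homogeneous in the
  weight.\<close>

definition pair :: "(('v \<Rightarrow> nat) \<Rightarrow> real) \<Rightarrow> (('v \<Rightarrow> nat) \<Rightarrow> real) \<Rightarrow> real" where
  "pair f g = (\<Sum>\<sigma>\<in>\<Omega>. weight \<sigma> * f \<sigma> * g \<sigma>)"

lemma finite_V: "finite V" and E_nsets: "E \<subseteq> nsets V 2"
  using graph by (auto simp: finite_simple_graph_def)

lemma finite_E: "finite E"
  by (rule finite_subset[of E "Pow V"]) (use finite_V E_nsets in \<open>auto simp: nsets_def\<close>)

lemma edgeD: "{u, v} \<in> E \<Longrightarrow> u \<in> V \<and> v \<in> V \<and> u \<noteq> v"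
  using E_nsets by (auto simp: nsets_def card_insert_if split: if_splits)

lemma edge_pair:
  assumes "e \<in> E"
  shows "\<exists>u v. e = {u, v}"
proof -
  have "card e = 2" using assms E_nsets by (auto simp: nsets_def)
  then show ?thesis by (auto simp: card_2_iff)
qed

lemma finite_configs: "finite \<Omega>"
  unfolding potts_configs_def by (intro finite_PiE finite_V) simp

lemma config_range: "\<sigma> \<in> \<Omega> \<Longrightarrow> v \<in> V \<Longrightarrow> \<sigma> v \<in> {1..q}"
  by (auto simp: potts_configs_def)

lemma config_update: "\<sigma> \<in> \<Omega> \<Longrightarrow> v \<in> V \<Longrightarrow> k \<in> {1..q} \<Longrightarrow> \<sigma>(v := k) \<in> \<Omega>"
  by (auto simp: potts_configs_def PiE_def extensional_def)

lemma mono_edges_eq: "mono_edges E \<sigma> = {e \<in> E. \<forall>a\<in>e. \<forall>b\<in>e. \<sigma> a = \<sigma> b}"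
proof
  show "mono_edges E \<sigma> \<subseteq> {e \<in> E. \<forall>a\<in>e. \<forall>b\<in>e. \<sigma> a = \<sigma> b}" by (auto simp: mono_edges_def)
  show "{e \<in> E. \<forall>a\<in>e. \<forall>b\<in>e. \<sigma> a = \<sigma> b} \<subseteq> mono_edges E \<sigma>"
  proof
    fix e assume e: "e \<in> {e \<in> E. \<forall>a\<in>e. \<forall>b\<in>e. \<sigma> a = \<sigma> b}"
    then have "e \<in> E" by simp
    from edge_pair[OF this] obtain u v where "e = {u, v}" by auto
    then show "e \<in> mono_edges E \<sigma>" using e by (auto simp: mono_edges_def)
  qed
qed

lemma mono_edges_subset: "mono_edges E \<sigma> \<subseteq> E"
  by (auto simp: mono_edges_eq)

lemma finite_mono: "finite (mono_edges E \<sigma>)"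
  using mono_edges_subset finite_E finite_subset by blast

lemma weight_pos: "0 < weight \<sigma>"
  by (simp add: weight_def)

text \<open>A compatible colouring is a colouring of the components of \<open>A\<close>. Hence the
  power of \<open>q\<close> in the kernel is the uniform probability on
  \<open>compatible A\<close>.\<close>

lemma card_compatible:
  assumes A: "A \<subseteq> E"
  shows "card (compatible A) = q ^ num_components V A"
proof -
  let ?R = "component_rel V A"
  have R: "equiv V ?R"
  proof (rule equivI)
    show "?R \<subseteq> V \<times> V" by (auto simp: component_rel_def)
    show "refl_on V ?R" by (auto simp: component_rel_def refl_on_def)
    show "sym ?R" using sym_reach[of A] by (auto simp: component_rel_def sym_def)
    show "trans ?R" by (auto simp: component_rel_def trans_def intro: rtrancl_trans)
  qed
  have const: "\<sigma> x = \<sigma> y" if "\<sigma> \<in> compatible A" "(x, y) \<in> ?R" for \<sigma> x y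
  proof -
    have "(x, y) \<in> reach A" using that by (auto simp: component_rel_def)
    then show ?thesis
    proof (induction rule: rtrancl_induct)
      case (step y z)
      then have "{y, z} \<in> mono_edges E \<sigma>" using that(1) by (auto simp: compatible_def)
      then have "\<sigma> y = \<sigma> z" unfolding mono_edges_eq by blast
      then show ?case using step.IH by simp
    qed simp
  qed
  let ?P = "V // ?R \<rightarrow>\<^sub>E {1..q}"
  let ?F = "\<lambda>g. \<lambda>v\<in>V. g (?R `` {v})"
  have cls: "?R `` {v} \<in> V // ?R" if "v \<in> V" for v using that by (rule quotientI)
  have "bij_betw ?F ?P (compatible A)"
    unfolding bij_betw_def
  proof
    show "inj_on ?F ?P"
    proof (rule inj_onI)
      fix g h assume gh: "g \<in> ?P" "h \<in> ?P" "?F g = ?F h"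
      show "g = h"
      proof (rule PiE_ext[OF gh(1,2)])
        fix c assume "c \<in> V // ?R"
        then obtain v where "v \<in> V" "c = ?R `` {v}" by (auto elim: quotientE)
        then show "g c = h c" using fun_cong[OF gh(3), of v] by simp
      qed
    qed
    show "?F ` ?P = compatible A"
    proof
      show "?F ` ?P \<subseteq> compatible A"
      proof
        fix \<sigma> assume "\<sigma> \<in> ?F ` ?P"
        then obtain g where g: "g \<in> ?P" "\<sigma> = ?F g" by auto
        have "\<sigma> \<in> \<Omega>" using g cls by (auto simp: potts_configs_def intro!: restrict_PiE_iff[THEN iffD2] dest: PiE_mem)
        moreover have "A \<subseteq> mono_edges E \<sigma>"
        proof
          fix e assume e: "e \<in> A"
          then obtain u v where uv: "e = {u, v}" using A edge_pair[of e] by blast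
          then have V: "u \<in> V" "v \<in> V" using edgeD[of u v] e A by auto
          then have "(u, v) \<in> ?R" using e uv by (auto simp: component_rel_def)
          then have "?R `` {u} = ?R `` {v}" using equiv_class_eq[OF R] by simp
          then have "\<sigma> u = \<sigma> v" using V g(2) by simp
          then show "e \<in> mono_edges E \<sigma>" using uv e A by (auto simp: mono_edges_eq)
        qed
        ultimately show "\<sigma> \<in> compatible A" by (simp add: compatible_def)
      qed
      show "compatible A \<subseteq> ?F ` ?P"
      proof
        fix \<sigma> assume \<sigma>: "\<sigma> \<in> compatible A"
        then have ext: "\<sigma> \<in> V \<rightarrow>\<^sub>E {1..q}" by (simp add: compatible_def potts_configs_def)
        define g where "g = (\<lambda>c\<in>V // ?R. \<sigma> (SOME x. x \<in> c))"
        have g: "g (?R `` {v}) = \<sigma> v" if v: "v \<in> V" for v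
        proof -
          have "v \<in> ?R `` {v}" by (rule equiv_class_self[OF R v])
          then have "(SOME x. x \<in> ?R `` {v}) \<in> ?R `` {v}" by (rule someI)
          then have "\<sigma> v = \<sigma> (SOME x. x \<in> ?R `` {v})" using const[OF \<sigma>] by blast
          then show ?thesis using cls[OF v] by (simp add: g_def)
        qed
        have "g \<in> ?P"
        proof (rule PiE_I)
          fix c assume "c \<in> V // ?R"
          then obtain v where "v \<in> V" "c = ?R `` {v}" by (auto elim: quotientE)
          then show "g c \<in> {1..q}" using g ext by auto
        qed (simp add: g_def)
        moreover have "?F g = \<sigma>"
        proof
          fix v show "?F g v = \<sigma> v" using g ext by (cases "v \<in> V") (auto simp: PiE_def extensional_def)
        qed
        ultimately show "\<sigma> \<in> ?F ` ?P" by blast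
      qed
    qed
  qed
  then have "card (compatible A) = card ?P" by (simp add: bij_betw_same_card)
  also have "\<dots> = q ^ num_components V A"
    using finite_quotient[OF finite_V] R
    by (simp add: card_PiE num_components_def equiv_def refl_on_def component_rel_def finite_quotient finite_V)
  finally show ?thesis .
qed

text \<open>The joint weight of colouring and percolation set: of the factor
  \<open>exp \<beta>\<close> for a monochromatic edge, an open edge keeps
  \<open>exp \<beta> - 1\<close> and a closed one keeps \<open>1\<close>. The result is symmetric in
  \<open>\<sigma>\<close> and \<open>\<tau>\<close>.\<close>

lemma weight_sw_kernel:
  "weight \<sigma> * sw_kernel V E \<beta> q \<sigma> \<tau> =
    (\<Sum>A\<in>Pow (mono_edges E \<sigma> \<inter> mono_edges E \<tau>). (exp \<beta> - 1) ^ card A / card (compatible A))"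
  unfolding sw_kernel_def Let_def sum_distrib_left
proof (rule sum.cong[OF refl])
  fix A assume "A \<in> Pow (mono_edges E \<sigma> \<inter> mono_edges E \<tau>)"
  then have A: "A \<subseteq> mono_edges E \<sigma>" "A \<subseteq> E" using mono_edges_subset by auto
  let ?m = "card (mono_edges E \<sigma>)" and ?a = "card A"
  have le: "?a \<le> ?m" using A(1) finite_mono by (rule card_mono[rotated])
  have "weight \<sigma> = exp \<beta> ^ ?a * exp \<beta> ^ (?m - ?a)"
    using le by (simp add: weight_def exp_of_nat2_mult power_add[symmetric] mult.commute)
  moreover have "exp \<beta> ^ (?m - ?a) * (1 - (1 - exp (- \<beta>))) ^ (?m - ?a) = 1"
    by (simp add: power_mult_distrib[symmetric] exp_minus_inverse)
  moreover have "exp \<beta> ^ ?a * (1 - exp (- \<beta>)) ^ ?a = (exp \<beta> - 1) ^ ?a"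
    by (simp add: power_mult_distrib[symmetric] algebra_simps exp_minus_inverse)
  ultimately have "weight \<sigma> * ((1 - exp (- \<beta>)) ^ ?a * (1 - (1 - exp (- \<beta>))) ^ (?m - ?a)) = (exp \<beta> - 1) ^ ?a"
    by (simp add: mult_ac)
  moreover have "real q powi - int (num_components V A) = 1 / card (compatible A)"
    unfolding card_compatible[OF A(2)] by (simp add: power_int_minus divide_inverse)
  ultimately show "weight \<sigma> * ((1 - exp (- \<beta>)) ^ ?a * (1 - (1 - exp (- \<beta>))) ^ (?m - ?a) *
      real q powi - int (num_components V A)) = (exp \<beta> - 1) ^ ?a / card (compatible A)"
    by (simp add: mult.assoc[symmetric])
qed

lemma reversible_weight: "reversible \<Omega> (sw_kernel V E \<beta> q) weight"
  unfolding reversible_def weight_sw_kernel by (simp add: Int_commute)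

text \<open>Given \<open>A\<close>, one step averages \<open>f\<close> over
  \<open>compatible A\<close>, hence the square. As every summand is nonnegative, the dynamics is
  positive semidefinite.\<close>

lemma sw_form:
  "(\<Sum>\<sigma>\<in>\<Omega>. weight \<sigma> * f \<sigma> * (\<Sum>\<tau>\<in>\<Omega>. sw_kernel V E \<beta> q \<sigma> \<tau> * f \<tau>)) =
    (\<Sum>A\<in>Pow E. (exp \<beta> - 1) ^ card A * ((\<Sum>\<sigma>\<in>compatible A. f \<sigma>)\<^sup>2 / card (compatible A)))"
proof -
  let ?c = "\<lambda>A \<sigma>. if A \<subseteq> mono_edges E \<sigma> then f \<sigma> else 0"
  let ?x = "\<lambda>A. (exp \<beta> - 1) ^ card A / card (compatible A)"
  have c: "(\<Sum>\<sigma>\<in>\<Omega>. ?c A \<sigma>) = (\<Sum>\<sigma>\<in>compatible A. f \<sigma>)" for A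
    unfolding compatible_def by (simp add: sum.inter_filter finite_configs)
  have "weight \<sigma> * f \<sigma> * (sw_kernel V E \<beta> q \<sigma> \<tau> * f \<tau>) = (\<Sum>A\<in>Pow E. ?x A * (?c A \<sigma> * ?c A \<tau>))" for \<sigma> \<tau>
  proof -
    have "weight \<sigma> * f \<sigma> * (sw_kernel V E \<beta> q \<sigma> \<tau> * f \<tau>) =
        (weight \<sigma> * sw_kernel V E \<beta> q \<sigma> \<tau>) * (f \<sigma> * f \<tau>)" by (simp add: mult_ac)
    also have "\<dots> = (\<Sum>A\<in>Pow (mono_edges E \<sigma> \<inter> mono_edges E \<tau>). ?x A * (?c A \<sigma> * ?c A \<tau>))"
      unfolding weight_sw_kernel sum_distrib_right by (intro sum.cong refl) auto
    also have "\<dots> = (\<Sum>A\<in>Pow E. ?x A * (?c A \<sigma> * ?c A \<tau>))"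
      using finite_E mono_edges_subset by (intro sum.mono_neutral_left) auto
    finally show ?thesis .
  qed
  then have "(\<Sum>\<sigma>\<in>\<Omega>. weight \<sigma> * f \<sigma> * (\<Sum>\<tau>\<in>\<Omega>. sw_kernel V E \<beta> q \<sigma> \<tau> * f \<tau>)) =
      (\<Sum>\<sigma>\<in>\<Omega>. \<Sum>\<tau>\<in>\<Omega>. \<Sum>A\<in>Pow E. ?x A * (?c A \<sigma> * ?c A \<tau>))"
    by (simp only: sum_distrib_left)
  also have "\<dots> = (\<Sum>A\<in>Pow E. \<Sum>\<sigma>\<in>\<Omega>. \<Sum>\<tau>\<in>\<Omega>. ?x A * (?c A \<sigma> * ?c A \<tau>))"
    by (simp only: sum.swap[of _ "Pow E" \<Omega>])
  also have "\<dots> = (\<Sum>A\<in>Pow E. ?x A * ((\<Sum>\<sigma>\<in>\<Omega>. ?c A \<sigma>) * (\<Sum>\<tau>\<in>\<Omega>. ?c A \<tau>)))"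
    by (subst sum_product) (simp only: sum_distrib_left)
  finally show ?thesis unfolding c by (simp add: power2_eq_square)
qed

text \<open>Exchanging the sums leaves a binomial sum over the subsets of the monochromatic edges in
  \<open>H\<close>. For \<open>H = E\<close> this recovers the Potts weight; the other use drops the
  edges at one vertex.\<close>

lemma sum_compatible:
  assumes "H \<subseteq> E"
  shows "(\<Sum>A\<in>Pow H. (exp \<beta> - 1) ^ card A * (\<Sum>\<sigma>\<in>compatible A. F \<sigma>)) =
    (\<Sum>\<sigma>\<in>\<Omega>. exp \<beta> ^ card (mono_edges E \<sigma> \<inter> H) * F \<sigma>)"
proof -
  have fH: "finite H" using assms finite_E finite_subset by auto
  have "(\<Sum>A\<in>Pow H. (exp \<beta> - 1) ^ card A * (\<Sum>\<sigma>\<in>compatible A. F \<sigma>)) =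
      (\<Sum>A\<in>Pow H. \<Sum>\<sigma>\<in>\<Omega>. if A \<subseteq> mono_edges E \<sigma> then (exp \<beta> - 1) ^ card A * F \<sigma> else 0)"
    unfolding compatible_def sum_distrib_left
    by (rule sum.cong[OF refl]) (rule sum.inter_filter[OF finite_configs])
  also have "\<dots> = (\<Sum>\<sigma>\<in>\<Omega>. \<Sum>A\<in>Pow H. if A \<subseteq> mono_edges E \<sigma> then (exp \<beta> - 1) ^ card A * F \<sigma> else 0)"
    by (rule sum.swap)
  also have "\<dots> = (\<Sum>\<sigma>\<in>\<Omega>. \<Sum>A\<in>Pow (mono_edges E \<sigma> \<inter> H). (exp \<beta> - 1) ^ card A * F \<sigma>)"
    using fH by (intro sum.cong refl sum.mono_neutral_cong_right) auto
  also have "\<dots> = (\<Sum>\<sigma>\<in>\<Omega>. exp \<beta> ^ card (mono_edges E \<sigma> \<inter> H) * F \<sigma>)"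
    unfolding sum_distrib_right[symmetric]
    using fH sum_Pow_power[of "_ \<inter> H" "exp \<beta> - 1"] by (simp del: Pow_Int_eq)
  finally show ?thesis .
qed

section \<open>Single-site resampling and comparison with the heat bath\<close>

abbreviation max_deg where "max_deg \<equiv> max_degree V E"

definition unif_mean :: "'v \<Rightarrow> (('v \<Rightarrow> nat) \<Rightarrow> real) \<Rightarrow> ('v \<Rightarrow> nat) \<Rightarrow> real" where
  "unif_mean v f \<sigma> = (\<Sum>k\<in>{1..q}. f (\<sigma>(v := k))) / q"

definition local_weight :: "'v \<Rightarrow> ('v \<Rightarrow> nat) \<Rightarrow> nat \<Rightarrow> real" where
  "local_weight v \<sigma> j = exp \<beta> ^ card {w \<in> V. {v, w} \<in> E \<and> \<sigma> w = j}"

definition heat_bath :: "'v \<Rightarrow> (('v \<Rightarrow> nat) \<Rightarrow> real) \<Rightarrow> ('v \<Rightarrow> nat) \<Rightarrow> real" where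
  "heat_bath v f \<sigma> = (\<Sum>k\<in>{1..q}. local_weight v \<sigma> k * f (\<sigma>(v := k))) / (\<Sum>k\<in>{1..q}. local_weight v \<sigma> k)"

definition glauber :: "(('v \<Rightarrow> nat) \<Rightarrow> real) \<Rightarrow> ('v \<Rightarrow> nat) \<Rightarrow> real" where
  "glauber f \<sigma> = (\<Sum>v\<in>V. heat_bath v f \<sigma>) / card V"

text \<open>Sending \<open>(\<sigma>, k)\<close> to \<open>(\<sigma>(v := k), \<sigma> v)\<close> is
  an involution: the discarded colour is stored in the second slot.\<close>

lemma resample_swap:
  assumes "\<And>\<sigma> k. \<sigma> \<in> S \<Longrightarrow> k \<in> {1..q} \<Longrightarrow> \<sigma>(v := k) \<in> S" "\<And>\<sigma>. \<sigma> \<in> S \<Longrightarrow> \<sigma> v \<in> {1..q}"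
  shows "(\<Sum>\<sigma>\<in>S. \<Sum>k\<in>{1..q}. H (\<sigma>(v := k)) (\<sigma> v)) = (\<Sum>\<sigma>\<in>S. \<Sum>k\<in>{1..q}. H \<sigma> k)"
  unfolding sum.cartesian_product
  by (rule sum.reindex_bij_witness[of _ "\<lambda>(\<sigma>, k). (\<sigma>(v := k), \<sigma> v)" "\<lambda>(\<sigma>, k). (\<sigma>(v := k), \<sigma> v)"])
     (use assms in auto)

lemma sum_unif_mean:
  assumes S: "\<And>\<sigma> k. \<sigma> \<in> S \<Longrightarrow> k \<in> {1..q} \<Longrightarrow> \<sigma>(v := k) \<in> S" "\<And>\<sigma>. \<sigma> \<in> S \<Longrightarrow> \<sigma> v \<in> {1..q}"
    and c: "\<And>\<sigma> k. c (\<sigma>(v := k)) = c \<sigma>"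
  shows "(\<Sum>\<sigma>\<in>S. f \<sigma> * c \<sigma>) = (\<Sum>\<sigma>\<in>S. unif_mean v f \<sigma> * c \<sigma>)"
proof -
  have "real q * (\<Sum>\<sigma>\<in>S. f \<sigma> * c \<sigma>) = (\<Sum>\<sigma>\<in>S. \<Sum>k\<in>{1..q}. f \<sigma> * c \<sigma>)"
    by (simp add: sum_distrib_left)
  also have "\<dots> = (\<Sum>\<sigma>\<in>S. \<Sum>k\<in>{1..q}. f (\<sigma>(v := k)) * c \<sigma>)"
    using resample_swap[of S v "\<lambda>\<sigma> k. f \<sigma> * c \<sigma>"] S by (simp add: c)
  also have "\<dots> = real q * (\<Sum>\<sigma>\<in>S. unif_mean v f \<sigma> * c \<sigma>)"
    using q_pos by (simp add: unif_mean_def sum_distrib_left sum_distrib_right[symmetric])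
  finally show ?thesis using q_pos by simp
qed

text \<open>For counting measure on \<open>S\<close>, \<open>unif_mean v\<close> is the orthogonal
  projection onto functions that ignore the colour at \<open>v\<close>. The sum of squares about the
  mean splits into a part within and a part between the fibres, and the latter is
  nonnegative.\<close>

lemma sum_square_deviation_le:
  assumes S: "\<And>\<sigma> k. \<sigma> \<in> S \<Longrightarrow> k \<in> {1..q} \<Longrightarrow> \<sigma>(v := k) \<in> S" "\<And>\<sigma>. \<sigma> \<in> S \<Longrightarrow> \<sigma> v \<in> {1..q}"
  shows "(\<Sum>\<sigma>\<in>S. (f \<sigma> - unif_mean v f \<sigma>)\<^sup>2) \<le> (\<Sum>\<sigma>\<in>S. (f \<sigma>)\<^sup>2) - (\<Sum>\<sigma>\<in>S. f \<sigma>)\<^sup>2 / card S"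
proof -
  let ?m = "unif_mean v f"
  have m: "?m (\<sigma>(v := k)) = ?m \<sigma>" for \<sigma> k by (simp add: unif_mean_def)
  have "(\<Sum>\<sigma>\<in>S. f \<sigma> * ?m \<sigma>) = (\<Sum>\<sigma>\<in>S. ?m \<sigma> * ?m \<sigma>)" by (rule sum_unif_mean) (use S m in auto)
  moreover have "(\<Sum>\<sigma>\<in>S. (f \<sigma> - ?m \<sigma>)\<^sup>2) =
      (\<Sum>\<sigma>\<in>S. (f \<sigma>)\<^sup>2) + (\<Sum>\<sigma>\<in>S. (?m \<sigma>)\<^sup>2) - 2 * (\<Sum>\<sigma>\<in>S. f \<sigma> * ?m \<sigma>)"
    by (simp add: power2_diff sum.distrib sum_subtractf sum_distrib_left mult.assoc)
  ultimately have "(\<Sum>\<sigma>\<in>S. (f \<sigma> - ?m \<sigma>)\<^sup>2) = (\<Sum>\<sigma>\<in>S. (f \<sigma>)\<^sup>2) - (\<Sum>\<sigma>\<in>S. (?m \<sigma>)\<^sup>2)"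
    by (simp add: power2_eq_square)
  moreover have "(\<Sum>\<sigma>\<in>S. f \<sigma>) = (\<Sum>\<sigma>\<in>S. ?m \<sigma>)" using sum_unif_mean[of S v "\<lambda>_. 1" f] S by simp
  moreover have "(\<Sum>\<sigma>\<in>S. ?m \<sigma>)\<^sup>2 / card S \<le> (\<Sum>\<sigma>\<in>S. (?m \<sigma>)\<^sup>2)"
    using sum_squared_le_sum_of_squares[of ?m S] by (cases "card S = 0") (simp_all add: divide_simps sum_nonneg)
  ultimately show ?thesis by simp
qed

lemma mono_edges_update:
  assumes "v \<notin> e"
  shows "e \<in> mono_edges E (\<sigma>(v := k)) \<longleftrightarrow> e \<in> mono_edges E \<sigma>"
proof -
  have "(\<sigma>(v := k)) a = \<sigma> a" if "a \<in> e" for a using assms that by auto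
  then show ?thesis unfolding mono_edges_eq by (simp del: fun_upd_apply)
qed

lemma weight_eq: "weight \<sigma> = exp \<beta> ^ card (mono_edges E \<sigma>)"
  by (simp add: weight_def exp_of_nat2_mult)

text \<open>The right side is a sum over \<open>A\<close> of nonnegative variances on
  \<open>compatible A\<close>. Only sets \<open>A\<close> without edges at \<open>v\<close> are
  kept; for them \<open>compatible A\<close> is closed under recolouring \<open>v\<close>, and
  resumming gives the Potts weight of the graph with \<open>v\<close> isolated.\<close>

lemma sw_dirichlet_ge:
  assumes v: "v \<in> V"
  shows "(\<Sum>\<sigma>\<in>\<Omega>. exp \<beta> ^ card (mono_edges E \<sigma> \<inter> {e \<in> E. v \<notin> e}) * (f \<sigma> - unif_mean v f \<sigma>)\<^sup>2) \<le>
    pair f f - (\<Sum>\<sigma>\<in>\<Omega>. weight \<sigma> * f \<sigma> * (\<Sum>\<tau>\<in>\<Omega>. sw_kernel V E \<beta> q \<sigma> \<tau> * f \<tau>))"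
proof -
  let ?x = "\<lambda>A. (exp \<beta> - 1) ^ card A" and ?E = "{e \<in> E. v \<notin> e}"
  let ?var = "\<lambda>A. (\<Sum>\<sigma>\<in>compatible A. (f \<sigma>)\<^sup>2) - (\<Sum>\<sigma>\<in>compatible A. f \<sigma>)\<^sup>2 / card (compatible A)"
  have x: "0 \<le> ?x A" for A using \<beta>_nonneg by simp
  have "pair f f = (\<Sum>\<sigma>\<in>\<Omega>. exp \<beta> ^ card (mono_edges E \<sigma> \<inter> E) * (f \<sigma>)\<^sup>2)"
    unfolding pair_def weight_eq using mono_edges_subset
    by (intro sum.cong refl) (simp add: power2_eq_square inf.absorb1)
  also have "\<dots> = (\<Sum>A\<in>Pow E. ?x A * (\<Sum>\<sigma>\<in>compatible A. (f \<sigma>)\<^sup>2))"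
    by (rule sum_compatible[symmetric]) simp
  finally have "pair f f - (\<Sum>\<sigma>\<in>\<Omega>. weight \<sigma> * f \<sigma> * (\<Sum>\<tau>\<in>\<Omega>. sw_kernel V E \<beta> q \<sigma> \<tau> * f \<tau>)) =
      (\<Sum>A\<in>Pow E. ?x A * ?var A)"
    unfolding sw_form by (simp add: sum_subtractf right_diff_distrib)
  moreover have "(\<Sum>A\<in>Pow ?E. ?x A * ?var A) \<le> (\<Sum>A\<in>Pow E. ?x A * ?var A)"
  proof (rule sum_mono2)
    fix A
    have "(\<Sum>\<sigma>\<in>compatible A. f \<sigma>)\<^sup>2 / card (compatible A) \<le> (\<Sum>\<sigma>\<in>compatible A. (f \<sigma>)\<^sup>2)"
      using sum_squared_le_sum_of_squares[of f "compatible A"]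
      by (cases "card (compatible A) = 0") (simp_all add: divide_simps sum_nonneg)
    then show "0 \<le> ?x A * ?var A" using x by (intro mult_nonneg_nonneg) simp_all
  qed (use finite_E in auto)
  moreover have "(\<Sum>A\<in>Pow ?E. ?x A * (\<Sum>\<sigma>\<in>compatible A. (f \<sigma> - unif_mean v f \<sigma>)\<^sup>2)) \<le>
      (\<Sum>A\<in>Pow ?E. ?x A * ?var A)"
  proof (intro sum_mono mult_left_mono x sum_square_deviation_le)
    fix A \<sigma> k assume A: "A \<in> Pow ?E" and \<sigma>: "\<sigma> \<in> compatible A" and k: "k \<in> {1..q}"
    have "A \<subseteq> mono_edges E (\<sigma>(v := k))"
    proof
      fix e assume e: "e \<in> A"
      then have "v \<notin> e" "e \<in> mono_edges E \<sigma>" using A \<sigma> by (auto simp: compatible_def)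
      then show "e \<in> mono_edges E (\<sigma>(v := k))" using mono_edges_update by blast
    qed
    then show "\<sigma>(v := k) \<in> compatible A"
      using \<sigma> config_update[OF _ v k] by (auto simp: compatible_def)
  next
    fix A \<sigma> assume "\<sigma> \<in> compatible A"
    then show "\<sigma> v \<in> {1..q}" using config_range v by (auto simp: compatible_def)
  qed
  moreover have "(\<Sum>A\<in>Pow ?E. ?x A * (\<Sum>\<sigma>\<in>compatible A. (f \<sigma> - unif_mean v f \<sigma>)\<^sup>2)) =
      (\<Sum>\<sigma>\<in>\<Omega>. exp \<beta> ^ card (mono_edges E \<sigma> \<inter> ?E) * (f \<sigma> - unif_mean v f \<sigma>)\<^sup>2)"
    by (rule sum_compatible) auto
  ultimately show ?thesis by linarith
qed

lemma degree_le: "v \<in> V \<Longrightarrow> card {e \<in> E. v \<in> e} \<le> max_deg"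
  unfolding max_degree_def using finite_V by (intro Max_ge) (auto simp: vertex_degree_def)

lemma weight_le:
  assumes "v \<in> V"
  shows "weight \<sigma> \<le> exp (\<beta> * max_deg) * exp \<beta> ^ card (mono_edges E \<sigma> \<inter> {e \<in> E. v \<notin> e})"
proof -
  let ?M = "mono_edges E \<sigma>"
  have "card ?M \<le> card ((?M \<inter> {e \<in> E. v \<notin> e}) \<union> {e \<in> E. v \<in> e})"
    using finite_E mono_edges_subset by (intro card_mono) auto
  also have "\<dots> \<le> card (?M \<inter> {e \<in> E. v \<notin> e}) + max_deg"
    using degree_le[OF assms] by (intro order.trans[OF card_Un_le]) simp
  finally have "weight \<sigma> \<le> exp \<beta> ^ (card (?M \<inter> {e \<in> E. v \<notin> e}) + max_deg)"
    unfolding weight_eq using \<beta>_nonneg by (intro power_increasing) auto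
  then show ?thesis by (simp add: power_add exp_of_nat2_mult mult.commute)
qed

lemma local_weight_pos: "0 < local_weight v \<sigma> j"
  by (simp add: local_weight_def)

lemma sum_local_weight_pos: "0 < (\<Sum>k\<in>{1..q}. local_weight v \<sigma> k)"
  using q_pos local_weight_pos by (intro sum_pos) auto

lemma local_weight_update: "local_weight v (\<sigma>(v := k)) = local_weight v \<sigma>"
proof
  fix j
  have "{w \<in> V. {v, w} \<in> E \<and> (\<sigma>(v := k)) w = j} = {w \<in> V. {v, w} \<in> E \<and> \<sigma> w = j}"
    using edgeD[of v v] by auto
  then show "local_weight v (\<sigma>(v := k)) j = local_weight v \<sigma> j" by (simp only: local_weight_def)
qed

lemma heat_bath_update: "heat_bath v f (\<sigma>(v := k)) = heat_bath v f \<sigma>"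
  by (simp add: heat_bath_def local_weight_update)

lemma weight_update:
  "weight (\<sigma>(v := j)) = exp \<beta> ^ card {e \<in> mono_edges E \<sigma>. v \<notin> e} * local_weight v \<sigma> j"
proof -
  let ?M = "mono_edges E (\<sigma>(v := j))" and ?W = "{w \<in> V. {v, w} \<in> E \<and> \<sigma> w = j}"
  have "{e \<in> ?M. v \<in> e} = (\<lambda>w. {v, w}) ` ?W"
  proof
    show "(\<lambda>w. {v, w}) ` ?W \<subseteq> {e \<in> ?M. v \<in> e}" using edgeD by (auto simp: mono_edges_eq)
    show "{e \<in> ?M. v \<in> e} \<subseteq> (\<lambda>w. {v, w}) ` ?W"
    proof
      fix e assume e: "e \<in> {e \<in> ?M. v \<in> e}"
      then have eE: "e \<in> E" using mono_edges_subset by auto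
      obtain a b where "e = {a, b}" using edge_pair[OF eE] by auto
      then obtain w where w: "e = {v, w}" using e by auto
      then have "w \<in> V" "v \<noteq> w" using edgeD[of v w] eE by auto
      have "\<forall>a\<in>e. \<forall>b\<in>e. (\<sigma>(v := j)) a = (\<sigma>(v := j)) b"
        using e unfolding mono_edges_eq by blast
      then have "(\<sigma>(v := j)) w = (\<sigma>(v := j)) v" unfolding w by blast
      then have "\<sigma> w = j" using \<open>v \<noteq> w\<close> by simp
      then show "e \<in> (\<lambda>w. {v, w}) ` ?W" using w \<open>w \<in> V\<close> eE by auto
    qed
  qed
  moreover have "inj_on (\<lambda>w. {v, w}) ?W" by (auto simp: inj_on_def doubleton_eq_iff)
  ultimately have "card {e \<in> ?M. v \<in> e} = card ?W" by (simp add: card_image)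
  moreover have "{e \<in> ?M. v \<notin> e} = {e \<in> mono_edges E \<sigma>. v \<notin> e}"
    using mono_edges_update by blast
  moreover have "card ?M = card {e \<in> ?M. v \<notin> e} + card {e \<in> ?M. v \<in> e}"
    using finite_mono by (subst card_Un_disjoint[symmetric]) (auto intro!: arg_cong[of _ _ card])
  ultimately show ?thesis by (simp add: weight_eq local_weight_def power_add)
qed

text \<open>Up to a factor that ignores the colour at \<open>v\<close>, \<open>weight\<close> is
  \<open>local_weight\<close>; this is detailed balance for resampling. It makes
  \<open>heat_bath v\<close> the orthogonal projection for \<open>pair\<close> onto functions that
  ignore the colour at \<open>v\<close>.\<close>

lemma heat_bath_adjoint:
  assumes v: "v \<in> V" and c: "\<And>\<sigma> k. c (\<sigma>(v := k)) = c \<sigma>"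
  shows "pair f c = pair (heat_bath v f) c"
proof -
  let ?Z = "\<lambda>\<sigma>. \<Sum>k\<in>{1..q}. local_weight v \<sigma> k"
  let ?H = "\<lambda>\<sigma> k. weight \<sigma> * f \<sigma> * c \<sigma> * local_weight v \<sigma> k / ?Z \<sigma>"
  have Z: "?Z \<sigma> \<noteq> 0" for \<sigma> using sum_local_weight_pos[of v \<sigma>] by simp
  have "pair f c = (\<Sum>\<sigma>\<in>\<Omega>. \<Sum>k\<in>{1..q}. ?H \<sigma> k)"
    unfolding pair_def
    by (intro sum.cong refl) (simp add: sum_divide_distrib[symmetric] sum_distrib_left[symmetric] Z del: One_nat_def)
  also have "\<dots> = (\<Sum>\<sigma>\<in>\<Omega>. \<Sum>k\<in>{1..q}. ?H (\<sigma>(v := k)) (\<sigma> v))"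
    using config_update config_range v by (intro resample_swap[symmetric]) auto
  also have "\<dots> = (\<Sum>\<sigma>\<in>\<Omega>. \<Sum>k\<in>{1..q}. weight \<sigma> * c \<sigma> * (local_weight v \<sigma> k * f (\<sigma>(v := k)) / ?Z \<sigma>))"
  proof (intro sum.cong refl)
    fix \<sigma> k
    have "weight (\<sigma>(v := k)) * local_weight v \<sigma> (\<sigma> v) = weight \<sigma> * local_weight v \<sigma> k"
      using weight_update[of \<sigma> v k] weight_update[of \<sigma> v "\<sigma> v"] by simp
    then show "?H (\<sigma>(v := k)) (\<sigma> v) = weight \<sigma> * c \<sigma> * (local_weight v \<sigma> k * f (\<sigma>(v := k)) / ?Z \<sigma>)"
      by (simp add: c local_weight_update mult_ac)
  qed
  also have "\<dots> = pair (heat_bath v f) c"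
    unfolding pair_def heat_bath_def
    by (intro sum.cong refl) (simp add: sum_distrib_left[symmetric] sum_divide_distrib[symmetric])
  finally show ?thesis .
qed

lemma pair_commute: "pair f g = pair g f"
  by (simp add: pair_def mult_ac)

lemma pair_self_nonneg: "0 \<le> pair f f"
  unfolding pair_def using weight_pos by (intro sum_nonneg) (simp add: mult.assoc less_imp_le)

lemma pair_diff: "pair (\<lambda>\<sigma>. f \<sigma> - g \<sigma>) (\<lambda>\<sigma>. f \<sigma> - g \<sigma>) = pair f f - 2 * pair f g + pair g g"
  by (simp add: pair_def algebra_simps sum.distrib sum_subtractf sum_distrib_left)

lemma pair_glauber: "card V * pair f (glauber g) = (\<Sum>v\<in>V. pair f (heat_bath v g))"
proof -
  have "(\<Sum>v\<in>V. pair f (heat_bath v g)) = (\<Sum>\<sigma>\<in>\<Omega>. weight \<sigma> * f \<sigma> * (\<Sum>v\<in>V. heat_bath v g \<sigma>))"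
    unfolding pair_def by (subst sum.swap) (simp add: sum_distrib_left)
  also have "\<dots> = card V * pair f (glauber g)"
    unfolding pair_def glauber_def sum_distrib_left[of "real (card V)"]
    using finite_V by (intro sum.cong refl) (auto simp: card_eq_0_iff)
  finally show ?thesis by simp
qed

lemma glauber_self_adjoint:
  assumes "V \<noteq> {}"
  shows "pair (glauber f) g = pair f (glauber g)"
proof -
  have "pair g (heat_bath v f) = pair f (heat_bath v g)" if "v \<in> V" for v
  proof -
    have "pair g (heat_bath v f) = pair (heat_bath v g) (heat_bath v f)"
      by (rule heat_bath_adjoint[OF that heat_bath_update])
    also have "\<dots> = pair (heat_bath v f) (heat_bath v g)" by (rule pair_commute)
    also have "\<dots> = pair f (heat_bath v g)"
      by (rule heat_bath_adjoint[OF that heat_bath_update, symmetric])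
    finally show ?thesis .
  qed
  then have "card V * pair g (glauber f) = card V * pair f (glauber g)"
    unfolding pair_glauber by simp
  then show ?thesis using assms finite_V pair_commute by simp
qed

text \<open>The left side is the squared distance from \<open>f\<close> to its projection, hence
  minimal among functions that ignore the colour at \<open>v\<close>; \<open>unif_mean v f\<close>
  is one of them.\<close>

lemma heat_bath_deviation_le:
  assumes "v \<in> V"
  shows "pair f f - pair f (heat_bath v f) \<le>
    pair (\<lambda>\<sigma>. f \<sigma> - unif_mean v f \<sigma>) (\<lambda>\<sigma>. f \<sigma> - unif_mean v f \<sigma>)"
proof -
  let ?m = "unif_mean v f" and ?h = "heat_bath v f"
  have "pair f ?m = pair ?h ?m"
    by (rule heat_bath_adjoint[OF assms]) (simp add: unif_mean_def)
  moreover have "pair f ?h = pair ?h ?h"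
    by (rule heat_bath_adjoint[OF assms heat_bath_update])
  ultimately show ?thesis
    using pair_diff[of f ?m] pair_diff[of ?h ?m] pair_self_nonneg[of "\<lambda>\<sigma>. ?h \<sigma> - ?m \<sigma>"] by linarith
qed

text \<open>The comparison loses no factor \<open>card V\<close>: the Swendsen-Wang Dirichlet form dominates each
  single-site Dirichlet form, hence their average.\<close>

lemma sw_glauber_comparison:
  assumes "V \<noteq> {}"
  shows "exp (- \<beta> * max_deg) * (pair f f - pair f (glauber f)) \<le>
    pair f f - (\<Sum>\<sigma>\<in>\<Omega>. weight \<sigma> * f \<sigma> * (\<Sum>\<tau>\<in>\<Omega>. sw_kernel V E \<beta> q \<sigma> \<tau> * f \<tau>))" (is "_ \<le> ?D")
proof -
  have "pair f f - pair f (heat_bath v f) \<le> exp (\<beta> * max_deg) * ?D" if v: "v \<in> V" for v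
  proof -
    let ?g = "\<lambda>\<sigma>. f \<sigma> - unif_mean v f \<sigma>"
    have "pair ?g ?g = (\<Sum>\<sigma>\<in>\<Omega>. weight \<sigma> * (?g \<sigma>)\<^sup>2)"
      by (simp add: pair_def power2_eq_square mult.assoc)
    also have "\<dots> \<le> (\<Sum>\<sigma>\<in>\<Omega>. exp (\<beta> * max_deg) * exp \<beta> ^ card (mono_edges E \<sigma> \<inter> {e \<in> E. v \<notin> e}) * (?g \<sigma>)\<^sup>2)"
      using weight_le[OF v] by (intro sum_mono mult_right_mono) auto
    also have "\<dots> \<le> exp (\<beta> * max_deg) * ?D"
      using mult_left_mono[OF sw_dirichlet_ge[OF v, of f], of "exp (\<beta> * max_deg)"]
      by (simp add: sum_distrib_left mult.assoc)
    finally show ?thesis using heat_bath_deviation_le[OF v, of f] by linarith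
  qed
  then have "(\<Sum>v\<in>V. pair f f - pair f (heat_bath v f)) \<le> (\<Sum>v\<in>V. exp (\<beta> * max_deg) * ?D)"
    by (rule sum_mono)
  then have "card V * (pair f f - pair f (glauber f)) \<le> card V * (exp (\<beta> * max_deg) * ?D)"
    by (simp add: sum_subtractf pair_glauber right_diff_distrib)
  then have "pair f f - pair f (glauber f) \<le> exp (\<beta> * max_deg) * ?D"
    using assms finite_V by (simp add: card_gt_0_iff)
  then have "exp (- \<beta> * max_deg) * (pair f f - pair f (glauber f)) \<le> exp (- \<beta> * max_deg) * (exp (\<beta> * max_deg) * ?D)"
    by (rule mult_left_mono) simp
  then show ?thesis by (simp add: mult.assoc[symmetric] exp_minus_inverse mult.commute flip: exp_add)
qed

end

section \<open>Perturbed averages, log-convex sequences and norms of nonnegative matrices\<close>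

lemma tanh_half_le:
  fixes b :: real
  assumes "0 \<le> b"
  shows "(exp b - 1) / (exp b + 1) \<le> b / 2"
proof -
  \<comment> \<open>Clearing denominators turns the claim into \<open>0 \<le> \<phi> b\<close>. Here
    \<open>\<phi> 0 = 0\<close>, and the derivative is nonnegative because
    \<open>1 - x \<le> exp (- x)\<close>.\<close>
  define \<phi> where "\<phi> x = 2 + x - exp x * (2 - x)" for x :: real
  have "\<phi> 0 \<le> \<phi> b"
  proof (rule DERIV_nonneg_imp_nondecreasing[OF assms])
    fix x :: real assume "0 \<le> x"
    have "(\<phi> has_real_derivative 1 - exp x * (1 - x)) (at x)"
      unfolding \<phi>_def by (auto intro!: derivative_eq_intros simp: algebra_simps)
    moreover have "exp x * (1 - x) \<le> exp x * exp (- x)"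
      using exp_ge_add_one_self[of "- x"] by (intro mult_left_mono) auto
    ultimately show "\<exists>y. (\<phi> has_real_derivative y) (at x) \<and> 0 \<le> y"
      by (auto simp: exp_minus_inverse)
  qed
  then have "2 * (exp b - 1) \<le> b * (exp b + 1)" by (simp add: \<phi>_def algebra_simps)
  then show ?thesis by (simp add: divide_le_eq add_pos_pos)
qed

text \<open>The odds \<open>x / y\<close> grow at most by the factor \<open>c\<^sup>2\<close>. The
  worst case is \<open>y = c * x\<close>, whence the square of \<open>c * x - y\<close> below. For
  \<open>c = exp t\<close> the bound is \<open>tanh (t / 2)\<close>.\<close>

lemma odds_ratio_le:
  fixes c x y x' y' :: real
  assumes c: "1 \<le> c" and pos: "0 \<le> x" "0 \<le> y" "0 \<le> x'" "0 \<le> y'" "0 < x + y" "0 < x' + y'"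
    and le: "x' \<le> c * x" "y \<le> c * y'"
  shows "x' / (x' + y') - x / (x + y) \<le> (c - 1) / (c + 1)"
proof -
  have "0 < c * x + y / c"
  proof (cases "x = 0")
    case True
    then show ?thesis using pos c by simp
  next
    case False
    then have "0 < c * x" using pos c by simp
    moreover have "0 \<le> y / c" using pos c by simp
    ultimately show ?thesis by linarith
  qed
  then have d: "0 < c\<^sup>2 * x + y" using c by (simp add: field_simps power2_eq_square)
  have "x' * y \<le> (c * x) * (c * y')" using le pos c by (intro mult_mono) auto
  then have "x' * (c\<^sup>2 * x + y) \<le> c\<^sup>2 * x * (x' + y')" by (simp add: power2_eq_square algebra_simps)
  then have "x' / (x' + y') \<le> c\<^sup>2 * x / (c\<^sup>2 * x + y)"
    using d pos by (simp add: frac_le_eq divide_le_0_iff field_simps)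
  moreover have "c\<^sup>2 * x / (c\<^sup>2 * x + y) - x / (x + y) \<le> (c - 1) / (c + 1)"
  proof -
    have eq: "c\<^sup>2 * x / (c\<^sup>2 * x + y) - x / (x + y) = (c\<^sup>2 - 1) * (x * y) / ((c\<^sup>2 * x + y) * (x + y))"
      using d pos by (simp add: field_simps)
    have "0 \<le> (c * x - y)\<^sup>2" by simp
    then have "(c + 1)\<^sup>2 * (x * y) \<le> (c\<^sup>2 * x + y) * (x + y)"
      by (simp add: power2_eq_square algebra_simps)
    then have "(c - 1) * ((c + 1)\<^sup>2 * (x * y)) \<le> (c - 1) * ((c\<^sup>2 * x + y) * (x + y))"
      using c by (intro mult_left_mono) auto
    then have "(c\<^sup>2 - 1) * (x * y) * (c + 1) \<le> (c - 1) * ((c\<^sup>2 * x + y) * (x + y))"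
      by (simp add: power2_eq_square algebra_simps)
    then show ?thesis unfolding eq using d pos c by (simp add: divide_le_eq pos_le_divide_eq mult_ac)
  qed
  ultimately show ?thesis by linarith
qed

text \<open>The difference of averages is at most total variation distance times oscillation. The
  distance is attained on the single set \<open>S\<close> where the new law exceeds the old one,
  which reduces everything to the two masses in \<open>odds_ratio_le\<close>.\<close>

lemma weighted_average_perturb:
  fixes a b F :: "'k \<Rightarrow> real"
  assumes fin: "finite J" "J \<noteq> {}" and pos: "\<And>j. j \<in> J \<Longrightarrow> 0 < a j" "\<And>j. j \<in> J \<Longrightarrow> 0 < b j"
    and t: "0 \<le> t" and ab: "\<And>j. j \<in> J \<Longrightarrow> b j \<le> exp t * a j" "\<And>j. j \<in> J \<Longrightarrow> a j \<le> exp t * b j"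
    and F: "\<And>i j. i \<in> J \<Longrightarrow> j \<in> J \<Longrightarrow> F i - F j \<le> D"
  shows "(\<Sum>j\<in>J. b j * F j) / sum b J - (\<Sum>j\<in>J. a j * F j) / sum a J \<le> t / 2 * D"
proof -
  let ?A = "sum a J" and ?B = "sum b J"
  have A: "0 < ?A" and B: "0 < ?B" using fin pos by (auto intro: sum_pos)
  define w where "w j = b j / ?B - a j / ?A" for j
  define S where "S = {j \<in> J. 0 < w j}"
  define m where "m = Min (F ` J)"
  have m: "m \<le> F j" "F j - m \<le> D" if "j \<in> J" for j
  proof -
    show "m \<le> F j" using fin that by (simp add: m_def)
    have "m \<in> F ` J" using fin by (simp add: m_def)
    then show "F j - m \<le> D" using F that by auto
  qed
  have D: "0 \<le> D" using F fin by force
  \<comment> \<open>Since the \<open>w j\<close> sum to zero, \<open>F\<close> may be shifted by its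
    minimum; then only positive \<open>w j\<close> contribute to an upper bound.\<close>
  have "sum w J = 0" using A B by (simp add: w_def sum_subtractf sum_divide_distrib[symmetric])
  then have "(\<Sum>j\<in>J. w j * F j) = (\<Sum>j\<in>J. w j * (F j - m))"
    by (simp add: right_diff_distrib sum_subtractf sum_distrib_right[symmetric])
  also have "\<dots> \<le> (\<Sum>j\<in>J. if 0 < w j then w j * D else 0)"
    using m by (intro sum_mono) (auto intro: mult_left_mono simp: mult_nonpos_nonneg not_less)
  also have "\<dots> = sum w S * D"
    using fin unfolding S_def sum_distrib_right by (simp only: sum.inter_filter)
  also have "\<dots> \<le> t / 2 * D"
  proof (rule mult_right_mono[OF _ D])
    have S: "S \<subseteq> J" "finite S" using fin by (auto simp: S_def)
    have split: "?A = sum a S + sum a (J - S)" "?B = sum b S + sum b (J - S)"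
      using S fin by (simp_all add: sum.subset_diff add.commute)
    have "sum w S = sum b S / (sum b S + sum b (J - S)) - sum a S / (sum a S + sum a (J - S))"
      unfolding split[symmetric] by (simp add: w_def sum_subtractf sum_divide_distrib)
    also have "\<dots> \<le> (exp t - 1) / (exp t + 1)"
    proof (rule odds_ratio_le)
      show "0 \<le> sum a S" "0 \<le> sum a (J - S)" "0 \<le> sum b S" "0 \<le> sum b (J - S)"
        using S pos by (auto intro!: sum_nonneg intro: less_imp_le)
      show "sum b S \<le> exp t * sum a S" "sum a (J - S) \<le> exp t * sum b (J - S)"
        unfolding sum_distrib_left using ab S by (auto intro!: sum_mono)
    qed (use t A B split in auto)
    also have "\<dots> \<le> t / 2" by (rule tanh_half_le[OF t])
    finally show "sum w S \<le> t / 2" .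
  qed
  also have "(\<Sum>j\<in>J. w j * F j) = (\<Sum>j\<in>J. b j * F j) / ?B - (\<Sum>j\<in>J. a j * F j) / ?A"
    by (simp add: w_def left_diff_distrib sum_subtractf sum_divide_distrib)
  finally show ?thesis .
qed

lemma weighted_average_abs_le:
  fixes a G :: "'k \<Rightarrow> real"
  assumes "\<And>j. j \<in> J \<Longrightarrow> 0 \<le> a j" "0 < sum a J" "\<And>j. j \<in> J \<Longrightarrow> \<bar>G j\<bar> \<le> d"
  shows "\<bar>(\<Sum>j\<in>J. a j * G j) / sum a J\<bar> \<le> d"
proof -
  have "\<bar>\<Sum>j\<in>J. a j * G j\<bar> \<le> (\<Sum>j\<in>J. a j * d)"
    using assms by (intro order.trans[OF sum_abs] sum_mono) (auto simp: abs_mult intro: mult_left_mono)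
  also have "\<dots> = d * sum a J" by (simp add: sum_distrib_left mult.commute)
  finally show ?thesis using assms(2) by (simp add: divide_le_eq)
qed

text \<open>Successive ratios of a log-convex sequence do not decrease, so \<open>b t\<close> is at
  least \<open>s ^ t * b 0\<close> with the initial ratio \<open>s\<close>. If \<open>s\<close>
  exceeded \<open>\<rho>\<close>, this would beat \<open>C * \<rho> ^ t\<close> for large
  \<open>t\<close>, whatever \<open>C\<close> is.\<close>

lemma log_convex_decay:
  fixes b :: "nat \<Rightarrow> real"
  assumes nonneg: "\<And>t. 0 \<le> b t" and lc: "\<And>t. (b (Suc t))\<^sup>2 \<le> b t * b (Suc (Suc t))"
    and bound: "\<And>t. b t \<le> C * \<rho> ^ t" and \<rho>: "0 \<le> \<rho>"
  shows "b 1 \<le> \<rho> * b 0"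
proof (rule ccontr)
  assume "\<not> ?thesis"
  then have gt: "\<rho> * b 0 < b 1" by simp
  have "b 0 \<noteq> 0"
  proof
    assume "b 0 = 0"
    then have "(b 1)\<^sup>2 \<le> 0" using lc[of 0] by simp
    then show False using gt \<open>b 0 = 0\<close> by simp
  qed
  then have b0: "0 < b 0" using nonneg[of 0] by simp
  define s where "s = b 1 / b 0"
  have s: "\<rho> < s" using gt b0 by (simp add: s_def field_simps)
  have step: "0 < b t \<and> s * b t \<le> b (Suc t)" for t
  proof (induction t)
    case 0
    then show ?case using b0 by (simp add: s_def)
  next
    case (Suc t)
    have "0 < s * b t" using Suc s \<rho> by simp
    then have pos: "0 < b (Suc t)" using Suc by linarith
    have "(s * b t) * b (Suc t) \<le> b (Suc t) * b (Suc t)"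
      using Suc pos by (intro mult_right_mono) auto
    also have "\<dots> \<le> b t * b (Suc (Suc t))" using lc[of t] by (simp add: power2_eq_square)
    finally have "b t * (s * b (Suc t)) \<le> b t * b (Suc (Suc t))" by (simp add: mult_ac)
    then show ?case using Suc pos by simp
  qed
  have ge: "s ^ t * b 0 \<le> b t" for t
  proof (induction t)
    case (Suc t)
    have "s ^ Suc t * b 0 = s * (s ^ t * b 0)" by simp
    also have "\<dots> \<le> s * b t" using Suc s \<rho> by (intro mult_left_mono) auto
    finally show ?case using step[of t] by linarith
  qed simp
  have "0 < s * b 0" using s b0 \<rho> by simp
  then have "\<rho> \<noteq> 0" using ge[of 1] bound[of 1] by auto
  then have r: "0 < \<rho>" using \<rho> by simp
  have "1 < s / \<rho>" using s r by simp
  then obtain t where "C / b 0 < (s / \<rho>) ^ t" using real_arch_pow by blast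
  then have "C * \<rho> ^ t < s ^ t * b 0" using r b0 by (simp add: power_divide field_simps)
  then show False using ge[of t] bound[of t] by linarith
qed

text \<open>An upper bound on the form does not by itself control negative eigenvalues;
  nonnegativity of \<open>a\<close> supplies this, through a test vector with nonnegative
  entries.\<close>

lemma norm_le_of_form:
  fixes x :: "'v \<Rightarrow> real"
  assumes sym: "\<And>u v. a u v = a v u" and a: "\<And>u v. 0 \<le> a u v" and \<rho>: "0 < \<rho>"
    and form: "\<And>z. (\<Sum>u\<in>V. \<Sum>v\<in>V. a u v * (z u * z v)) \<le> \<rho> * (\<Sum>u\<in>V. (z u)\<^sup>2)"
  shows "(\<Sum>u\<in>V. (\<Sum>v\<in>V. a u v * x v)\<^sup>2) \<le> \<rho>\<^sup>2 * (\<Sum>u\<in>V. (x u)\<^sup>2)"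
proof -
  define y where "y u = (\<Sum>v\<in>V. a u v * x v)" for u
  \<comment> \<open>\<open>z u\<close> is the length of the plane vector
    \<open>(\<rho> * x u, y u)\<close>, and \<open>cs\<close> is Cauchy-Schwarz for it and
    \<open>(y v, \<rho> * x v)\<close>.\<close>
  define z where "z u = sqrt ((\<rho> * x u)\<^sup>2 + (y u)\<^sup>2)" for u
  have z2: "(z u)\<^sup>2 = \<rho>\<^sup>2 * (x u)\<^sup>2 + (y u)\<^sup>2" for u by (simp add: z_def power_mult_distrib)
  have cs: "\<rho> * (y u * x v + x u * y v) \<le> z u * z v" for u v
  proof (rule power2_le_imp_le)
    have "0 \<le> (\<rho> * x u * (\<rho> * x v) - y u * y v)\<^sup>2" by simp
    then show "(\<rho> * (y u * x v + x u * y v))\<^sup>2 \<le> (z u * z v)\<^sup>2"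
      unfolding power_mult_distrib z2 by (simp add: power2_eq_square algebra_simps)
    show "0 \<le> z u * z v" by (simp add: z_def)
  qed
  have y1: "(\<Sum>u\<in>V. (y u)\<^sup>2) = (\<Sum>u\<in>V. \<Sum>v\<in>V. a u v * (y u * x v))"
    by (simp add: power2_eq_square y_def sum_distrib_left mult_ac)
  also have "\<dots> = (\<Sum>u\<in>V. \<Sum>v\<in>V. a u v * (x u * y v))"
    by (subst sum.swap) (simp add: sym mult.commute)
  finally have y2: "(\<Sum>u\<in>V. (y u)\<^sup>2) = (\<Sum>u\<in>V. \<Sum>v\<in>V. a u v * (x u * y v))" .
  have "2 * \<rho> * (\<Sum>u\<in>V. (y u)\<^sup>2) = \<rho> * (\<Sum>u\<in>V. (y u)\<^sup>2) + \<rho> * (\<Sum>u\<in>V. (y u)\<^sup>2)" by simp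
  also have "\<dots> = \<rho> * (\<Sum>u\<in>V. \<Sum>v\<in>V. a u v * (y u * x v)) + \<rho> * (\<Sum>u\<in>V. \<Sum>v\<in>V. a u v * (x u * y v))"
    using y1 y2 by simp
  also have "\<dots> = (\<Sum>u\<in>V. \<Sum>v\<in>V. a u v * (\<rho> * (y u * x v + x u * y v)))"
    by (simp add: algebra_simps sum.distrib sum_distrib_left)
  also have "\<dots> \<le> (\<Sum>u\<in>V. \<Sum>v\<in>V. a u v * (z u * z v))"
    using cs a by (intro sum_mono mult_left_mono)
  also have "\<dots> \<le> \<rho> * (\<Sum>u\<in>V. (z u)\<^sup>2)" by (rule form)
  also have "\<dots> = \<rho> * (\<rho>\<^sup>2 * (\<Sum>u\<in>V. (x u)\<^sup>2) + (\<Sum>u\<in>V. (y u)\<^sup>2))"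
    by (simp add: z2 sum.distrib sum_distrib_left)
  finally have "\<rho> * (\<Sum>u\<in>V. (y u)\<^sup>2) \<le> \<rho> * (\<rho>\<^sup>2 * (\<Sum>u\<in>V. (x u)\<^sup>2))"
    by (simp add: algebra_simps)
  then show ?thesis using \<rho> by (simp add: y_def)
qed

section \<open>Decay of oscillations and the Poincare inequality for the heat bath\<close>

context potts begin

definition oscillation_bound :: "(('v \<Rightarrow> nat) \<Rightarrow> real) \<Rightarrow> ('v \<Rightarrow> real) \<Rightarrow> bool" where
  "oscillation_bound f d \<longleftrightarrow> (\<forall>u\<in>V. \<forall>\<sigma>\<in>\<Omega>. \<forall>k\<in>{1..q}. \<bar>f (\<sigma>(u := k)) - f \<sigma>\<bar> \<le> d u)"

definition adj :: "'v \<Rightarrow> 'v \<Rightarrow> real" where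
  "adj u v = (if {u, v} \<in> E then 1 else 0)"

text \<open>One step forgets the colour at \<open>u\<close> with probability
  \<open>1 / card V\<close>, while each neighbour \<open>v\<close>, when resampled, passes on at
  most \<open>\<beta> / 2\<close> times its own oscillation.\<close>

definition influence :: "('v \<Rightarrow> real) \<Rightarrow> 'v \<Rightarrow> real" where
  "influence d u = (1 - 1 / card V) * d u + \<beta> / (2 * real (card V)) * (\<Sum>v\<in>V. adj u v * d v)"

lemma oscillation_boundD:
  "oscillation_bound f d \<Longrightarrow> u \<in> V \<Longrightarrow> \<sigma> \<in> \<Omega> \<Longrightarrow> k \<in> {1..q} \<Longrightarrow> \<bar>f (\<sigma>(u := k)) - f \<sigma>\<bar> \<le> d u"
  by (simp add: oscillation_bound_def)

text \<open>Changing the integrand under a fixed law costs \<open>d u\<close>; changing the law for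
  a fixed integrand costs \<open>\<beta> / 2 * d v\<close>, and only if \<open>u\<close> and
  \<open>v\<close> are adjacent.\<close>

lemma heat_bath_oscillation:
  assumes osc: "oscillation_bound f d" and uv: "u \<in> V" "v \<in> V" "u \<noteq> v"
    and \<sigma>: "\<sigma> \<in> \<Omega>" and k: "k \<in> {1..q}"
  shows "\<bar>heat_bath v f (\<sigma>(u := k)) - heat_bath v f \<sigma>\<bar> \<le> d u + \<beta> / 2 * (adj u v * d v)"
proof -
  let ?\<tau> = "\<sigma>(u := k)" and ?J = "{1..q}"
  let ?a = "local_weight v \<sigma>" and ?b = "local_weight v ?\<tau>"
  let ?F = "\<lambda>j. f (\<sigma>(v := j))" and ?G = "\<lambda>j. f (?\<tau>(v := j))"
  have first: "\<bar>(\<Sum>j\<in>?J. ?b j * (?G j - ?F j)) / sum ?b ?J\<bar> \<le> d u"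
  proof (rule weighted_average_abs_le)
    fix j assume j: "j \<in> ?J"
    have "?\<tau>(v := j) = (\<sigma>(v := j))(u := k)" using uv by (simp add: fun_upd_twist)
    then show "\<bar>?G j - ?F j\<bar> \<le> d u"
      using oscillation_boundD[OF osc uv(1) config_update[OF \<sigma> uv(2) j] k] by simp
  qed (use local_weight_pos sum_local_weight_pos in \<open>auto intro: less_imp_le simp del: One_nat_def\<close>)
  have second: "\<bar>(\<Sum>j\<in>?J. ?b j * ?F j) / sum ?b ?J - (\<Sum>j\<in>?J. ?a j * ?F j) / sum ?a ?J\<bar> \<le> \<beta> / 2 * (adj u v * d v)"
  proof (cases "{u, v} \<in> E")
    case False
    have "{w \<in> V. {v, w} \<in> E \<and> ?\<tau> w = j} = {w \<in> V. {v, w} \<in> E \<and> \<sigma> w = j}" for j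
      using False by (auto simp: insert_commute)
    then have "?b = ?a" unfolding local_weight_def by (simp del: fun_upd_apply)
    then show ?thesis using False by (simp add: adj_def)
  next
    case True
    have ab: "?b j \<le> exp \<beta> * ?a j \<and> ?a j \<le> exp \<beta> * ?b j" for j
    proof -
      let ?A = "{w \<in> V. {v, w} \<in> E \<and> \<sigma> w = j}" and ?B = "{w \<in> V. {v, w} \<in> E \<and> ?\<tau> w = j}"
      have fin: "finite ?A" "finite ?B" using finite_V by (auto intro: finite_subset[of _ V])
      \<comment> \<open>Recolouring \<open>u\<close> changes the number of neighbours of
        \<open>v\<close> of any given colour by at most one.\<close>
      have "card ?B \<le> card (insert u ?A)" "card ?A \<le> card (insert u ?B)"
        using fin by (auto intro!: card_mono simp del: fun_upd_apply simp: fun_upd_other)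
      then have "card ?B \<le> Suc (card ?A)" "card ?A \<le> Suc (card ?B)"
        using fin by (auto simp: card_insert_if simp del: fun_upd_apply split: if_splits)
      then show ?thesis
        using \<beta>_nonneg power_increasing[of "card ?B" "Suc (card ?A)" "exp \<beta>"]
          power_increasing[of "card ?A" "Suc (card ?B)" "exp \<beta>"]
        by (simp add: local_weight_def)
    qed
    have F: "?F i - ?F j \<le> d v" if "i \<in> ?J" "j \<in> ?J" for i j
      using oscillation_boundD[OF osc uv(2) config_update[OF \<sigma> uv(2) that(2)] that(1)] by simp
    have J: "finite ?J" "?J \<noteq> {}" using q_pos by auto
    have "(\<Sum>j\<in>?J. ?b j * ?F j) / sum ?b ?J - (\<Sum>j\<in>?J. ?a j * ?F j) / sum ?a ?J \<le> \<beta> / 2 * d v"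
      by (rule weighted_average_perturb[OF J]) (use ab F \<beta>_nonneg local_weight_pos in auto)
    moreover have "(\<Sum>j\<in>?J. ?a j * ?F j) / sum ?a ?J - (\<Sum>j\<in>?J. ?b j * ?F j) / sum ?b ?J \<le> \<beta> / 2 * d v"
      by (rule weighted_average_perturb[OF J]) (use ab F \<beta>_nonneg local_weight_pos in auto)
    ultimately have "\<bar>(\<Sum>j\<in>?J. ?b j * ?F j) / sum ?b ?J - (\<Sum>j\<in>?J. ?a j * ?F j) / sum ?a ?J\<bar> \<le> \<beta> / 2 * d v"
      by linarith
    moreover have "adj u v * d v = d v" using True by (simp add: adj_def)
    ultimately show ?thesis by (simp only:)
  qed
  have "heat_bath v f ?\<tau> - heat_bath v f \<sigma> = (\<Sum>j\<in>?J. ?b j * (?G j - ?F j)) / sum ?b ?J +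
      ((\<Sum>j\<in>?J. ?b j * ?F j) / sum ?b ?J - (\<Sum>j\<in>?J. ?a j * ?F j) / sum ?a ?J)"
    by (simp add: heat_bath_def right_diff_distrib sum_subtractf diff_divide_distrib)
  then show ?thesis using first second by linarith
qed

lemma oscillation_bound_glauber:
  assumes osc: "oscillation_bound f d"
  shows "oscillation_bound (glauber f) (influence d)"
  unfolding oscillation_bound_def
proof (intro ballI)
  fix u \<sigma> k assume u: "u \<in> V" and \<sigma>: "\<sigma> \<in> \<Omega>" and k: "k \<in> {1..q}"
  have N: "0 < card V" using u finite_V card_gt_0_iff by blast
  let ?D = "\<lambda>v. heat_bath v f (\<sigma>(u := k)) - heat_bath v f \<sigma>"
  have "\<bar>?D v\<bar> \<le> (if v = u then 0 else d u) + \<beta> / 2 * (adj u v * d v)" if "v \<in> V" for v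
  proof (cases "v = u")
    case True
    then show ?thesis using edgeD[of u u] by (auto simp: heat_bath_update adj_def)
  next
    case False
    then show ?thesis using heat_bath_oscillation[OF osc u that _ \<sigma> k] by auto
  qed
  then have "(\<Sum>v\<in>V. \<bar>?D v\<bar>) \<le> (\<Sum>v\<in>V. (if v = u then 0 else d u) + \<beta> / 2 * (adj u v * d v))"
    by (rule sum_mono)
  also have "\<dots> = (\<Sum>v\<in>V. if v = u then 0 else d u) + \<beta> / 2 * (\<Sum>v\<in>V. adj u v * d v)"
    by (simp only: sum.distrib sum_distrib_left)
  also have "(\<Sum>v\<in>V. if v = u then 0 else d u) = (card V - 1) * d u"
    using finite_V u by (simp add: sum.remove[OF finite_V u])
  also have "(card V - 1) * d u + \<beta> / 2 * (\<Sum>v\<in>V. adj u v * d v) = card V * influence d u"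
  proof -
    have "real (card V - 1) = card V * (1 - 1 / card V)" "\<beta> / 2 = card V * (\<beta> / (2 * card V))"
      using N by (simp_all add: right_diff_distrib of_nat_diff)
    then show ?thesis by (simp only: influence_def distrib_left mult.assoc of_nat_mult of_nat_numeral)
  qed
  finally have "\<bar>\<Sum>v\<in>V. ?D v\<bar> \<le> card V * influence d u"
    using sum_abs[of ?D V] by linarith
  moreover have "glauber f (\<sigma>(u := k)) - glauber f \<sigma> = (\<Sum>v\<in>V. ?D v) / card V"
    by (simp add: glauber_def sum_subtractf diff_divide_distrib)
  ultimately show "\<bar>glauber f (\<sigma>(u := k)) - glauber f \<sigma>\<bar> \<le> influence d u"
    using N by (simp add: divide_le_eq mult.commute)
qed

lemma oscillation_le_sum:
  assumes osc: "oscillation_bound f d" and \<sigma>: "\<sigma> \<in> \<Omega>" and \<tau>: "\<tau> \<in> \<Omega>"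
  shows "\<bar>f \<sigma> - f \<tau>\<bar> \<le> (\<Sum>u\<in>V. d u)"
proof -
  let ?mix = "\<lambda>S v. if v \<in> S then \<sigma> v else \<tau> v"
  have "?mix S \<in> \<Omega> \<and> \<bar>f (?mix S) - f \<tau>\<bar> \<le> (\<Sum>u\<in>S. d u)" if "S \<subseteq> V" for S
    using finite_subset[OF that finite_V] that
  proof (induction S rule: finite_induct)
    case empty
    then show ?case using \<tau> by simp
  next
    case (insert u S)
    then have IH: "?mix S \<in> \<Omega>" "\<bar>f (?mix S) - f \<tau>\<bar> \<le> (\<Sum>u\<in>S. d u)" and u: "u \<in> V" by auto
    have eq: "?mix (insert u S) = (?mix S)(u := \<sigma> u)" by auto
    have r: "\<sigma> u \<in> {1..q}" using config_range[OF \<sigma> u] .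
    have "?mix (insert u S) \<in> \<Omega>" unfolding eq by (rule config_update[OF IH(1) u r])
    moreover have "\<bar>f (?mix (insert u S)) - f (?mix S)\<bar> \<le> d u"
      unfolding eq by (rule oscillation_boundD[OF osc u IH(1) r])
    ultimately show ?case using IH(2) insert.hyps by (simp del: insert_iff)
  qed
  from this[of V] have "\<bar>f (?mix V) - f \<tau>\<bar> \<le> (\<Sum>u\<in>V. d u)" by simp
  moreover have "?mix V = \<sigma>"
    using \<sigma> \<tau> by (auto simp: potts_configs_def PiE_def extensional_def)
  ultimately show ?thesis by simp
qed

text \<open>With mean zero, \<open>f \<sigma>\<close> is the weighted average of the differences
  \<open>f \<sigma> - f \<tau>\<close>.\<close>

lemma pair_le_oscillation:
  assumes osc: "oscillation_bound f d" and mean: "pair f (\<lambda>_. 1) = 0"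
  shows "pair f f \<le> (\<Sum>\<sigma>\<in>\<Omega>. weight \<sigma>) * (\<Sum>u\<in>V. d u)\<^sup>2"
proof -
  have "\<bar>f \<sigma>\<bar> \<le> (\<Sum>u\<in>V. d u)" if \<sigma>: "\<sigma> \<in> \<Omega>" for \<sigma>
  proof -
    let ?W = "\<Sum>\<tau>\<in>\<Omega>. weight \<tau>"
    have W: "0 < ?W" using \<sigma> weight_pos finite_configs by (intro sum_pos) auto
    have "?W * f \<sigma> = (\<Sum>\<tau>\<in>\<Omega>. weight \<tau> * (f \<sigma> - f \<tau>))"
      using mean by (simp add: pair_def right_diff_distrib sum_subtractf sum_distrib_right)
    then have "?W * \<bar>f \<sigma>\<bar> = \<bar>\<Sum>\<tau>\<in>\<Omega>. weight \<tau> * (f \<sigma> - f \<tau>)\<bar>"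
      using W by (metis abs_mult abs_of_pos)
    also have "\<dots> \<le> (\<Sum>\<tau>\<in>\<Omega>. weight \<tau> * (\<Sum>u\<in>V. d u))"
      using oscillation_le_sum[OF osc \<sigma>] weight_pos
      by (intro order.trans[OF sum_abs] sum_mono) (simp add: abs_mult less_imp_le)
    also have "\<dots> = ?W * (\<Sum>u\<in>V. d u)" by (simp add: sum_distrib_right)
    finally show ?thesis using W by simp
  qed
  then have "pair f f \<le> (\<Sum>\<sigma>\<in>\<Omega>. weight \<sigma> * (\<Sum>u\<in>V. d u)\<^sup>2)"
    unfolding pair_def mult.assoc power2_eq_square[symmetric] using weight_pos
    by (intro sum_mono mult_left_mono) (auto simp: abs_le_square_iff[symmetric] less_imp_le dest: order.trans[OF _ abs_ge_self])
  then show ?thesis by (simp add: sum_distrib_right)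
qed

lemma pair_Cauchy_Schwarz: "(pair f g)\<^sup>2 \<le> pair f f * pair g g"
proof -
  have "pair f g = (\<Sum>\<sigma>\<in>\<Omega>. (sqrt (weight \<sigma>) * f \<sigma>) * (sqrt (weight \<sigma>) * g \<sigma>))" for f g
    unfolding pair_def using weight_pos
    by (intro sum.cong refl) (simp add: mult_ac less_imp_le flip: mult.assoc[of "sqrt _"])
  then show ?thesis
    using Cauchy_Schwarz_ineq_sum[of "\<lambda>\<sigma>. sqrt (weight \<sigma>) * f \<sigma>" "\<lambda>\<sigma>. sqrt (weight \<sigma>) * g \<sigma>" \<Omega>]
    by (simp add: power2_eq_square)
qed

lemma influence_contraction:
  assumes \<rho>: "0 < \<rho>" and V: "V \<noteq> {}"
    and form: "\<And>z. (\<Sum>u\<in>V. \<Sum>v\<in>V. adj u v * (z u * z v)) \<le> \<rho> * (\<Sum>u\<in>V. (z u)\<^sup>2)"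
  shows "L2_set (influence d) V \<le> (1 - 1 / card V + \<beta> * \<rho> / (2 * real (card V))) * L2_set d V"
proof -
  let ?N = "real (card V)" and ?y = "\<lambda>u. \<Sum>v\<in>V. adj u v * d v"
  have N: "1 \<le> ?N" using V finite_V by (simp add: Suc_le_eq card_gt_0_iff)
  have "(\<Sum>u\<in>V. (?y u)\<^sup>2) \<le> \<rho>\<^sup>2 * (\<Sum>u\<in>V. (d u)\<^sup>2)"
    by (rule norm_le_of_form[OF _ _ \<rho> form]) (auto simp: adj_def insert_commute)
  then have y: "L2_set ?y V \<le> \<rho> * L2_set d V"
    unfolding L2_set_def using \<rho> by (intro real_le_lsqrt) (auto simp: power_mult_distrib sum_nonneg)
  have "L2_set (influence d) V \<le> L2_set (\<lambda>u. (1 - 1 / ?N) * d u) V + L2_set (\<lambda>u. \<beta> / (2 * ?N) * ?y u) V"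
    unfolding influence_def by (rule L2_set_triangle_ineq)
  also have "\<dots> = (1 - 1 / ?N) * L2_set d V + \<beta> / (2 * ?N) * L2_set ?y V"
  proof -
    have "(1 - 1 / ?N) * L2_set d V = L2_set (\<lambda>u. (1 - 1 / ?N) * d u) V"
      by (rule L2_set_right_distrib) (use N in simp)
    moreover have "\<beta> / (2 * ?N) * L2_set ?y V = L2_set (\<lambda>u. \<beta> / (2 * ?N) * ?y u) V"
      by (rule L2_set_right_distrib) (use \<beta>_nonneg in simp)
    ultimately show ?thesis by simp
  qed
  also have "\<dots> \<le> (1 - 1 / ?N) * L2_set d V + \<beta> / (2 * ?N) * (\<rho> * L2_set d V)"
    using y \<beta>_nonneg by (intro add_left_mono mult_left_mono) auto
  finally show ?thesis by (simp add: algebra_simps)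
qed

lemma glauber_poincare:
  assumes \<rho>: "0 < \<rho>" and V: "V \<noteq> {}"
    and form: "\<And>z. (\<Sum>u\<in>V. \<Sum>v\<in>V. adj u v * (z u * z v)) \<le> \<rho> * (\<Sum>u\<in>V. (z u)\<^sup>2)"
    and mean: "pair f (\<lambda>_. 1) = 0"
  shows "pair f (glauber f) \<le> (1 - 1 / card V + \<beta> * \<rho> / (2 * real (card V))) * pair f f"
proof -
  let ?N = "real (card V)"
  define r where "r = 1 - 1 / ?N + \<beta> * \<rho> / (2 * ?N)"
  have N: "1 \<le> ?N" using V finite_V by (simp add: Suc_le_eq card_gt_0_iff)
  have r: "0 \<le> r" using N \<rho> \<beta>_nonneg by (simp add: r_def)
  \<comment> \<open>A crude common bound on all oscillations of \<open>f\<close>; it enters only the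
    prefactor of the decay.\<close>
  define C where "C = 2 * (\<Sum>\<sigma>\<in>\<Omega>. \<bar>f \<sigma>\<bar>)"
  define d where "d t = (influence ^^ t) (\<lambda>_. C)" for t
  define g where "g t = (glauber ^^ t) f" for t
  have fC: "\<bar>f \<sigma>\<bar> \<le> C / 2" if "\<sigma> \<in> \<Omega>" for \<sigma>
    using member_le_sum[OF that, of "\<lambda>\<sigma>. \<bar>f \<sigma>\<bar>"] finite_configs by (simp add: C_def)
  have osc: "oscillation_bound (g t) (d t)" for t
  proof (induction t)
    case 0
    show ?case unfolding oscillation_bound_def
    proof (intro ballI)
      fix u \<sigma> k assume "u \<in> V" "\<sigma> \<in> \<Omega>" "k \<in> {1..q}"
      then show "\<bar>g 0 (\<sigma>(u := k)) - g 0 \<sigma>\<bar> \<le> d 0 u"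
        using fC[of \<sigma>] fC[OF config_update, of \<sigma> u k] by (simp add: g_def d_def)
    qed
  next
    case (Suc t)
    then show ?case using oscillation_bound_glauber by (simp add: g_def d_def)
  qed
  have dr: "L2_set (d t) V \<le> r ^ t * L2_set (d 0) V" for t
  proof (induction t)
    case (Suc t)
    have "L2_set (d (Suc t)) V \<le> r * L2_set (d t) V"
      using influence_contraction[OF \<rho> V form, of "d t"] by (simp add: d_def r_def)
    also have "\<dots> \<le> r * (r ^ t * L2_set (d 0) V)" using Suc r by (intro mult_left_mono)
    finally show ?case by simp
  qed simp
  have mean_g: "pair (g t) (\<lambda>_. 1) = 0" for t
  proof (induction t)
    case 0
    show ?case using mean by (simp add: g_def)
  next
    case (Suc t)
    have "?N * pair (\<lambda>_. 1) (glauber (g t)) = (\<Sum>v\<in>V. pair (\<lambda>_. 1) (heat_bath v (g t)))"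
      by (rule pair_glauber)
    also have "\<dots> = (\<Sum>v\<in>V. pair (g t) (\<lambda>_. 1))"
      using heat_bath_adjoint[of _ "\<lambda>_. 1" "g t"] by (intro sum.cong refl) (simp add: pair_commute)
    finally show ?case using Suc N by (simp add: g_def pair_commute)
  qed
  let ?W = "\<Sum>\<sigma>\<in>\<Omega>. weight \<sigma>"
  define b where "b t = pair (g t) (g t)" for t
  have "b 1 \<le> r\<^sup>2 * b 0"
  proof (rule log_convex_decay)
    show "0 \<le> b t" for t unfolding b_def by (rule pair_self_nonneg)
    show "0 \<le> r\<^sup>2" by simp
  next
    fix t
    \<comment> \<open>Self-adjointness moves one \<open>glauber\<close> across the inner product;
      Cauchy-Schwarz then gives log-convexity.\<close>
    have "b (Suc t) = pair (g t) (g (Suc (Suc t)))"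
      unfolding b_def g_def using glauber_self_adjoint[OF V] by simp
    then show "(b (Suc t))\<^sup>2 \<le> b t * b (Suc (Suc t))"
      unfolding b_def by (simp add: pair_Cauchy_Schwarz)
  next
    fix t
    have "(\<Sum>u\<in>V. d t u)\<^sup>2 \<le> ?N * (L2_set (d t) V)\<^sup>2"
      using sum_squared_le_sum_of_squares[of "d t" V] by (simp add: L2_set_def sum_nonneg mult.commute)
    also have "\<dots> \<le> ?N * (r ^ t * L2_set (d 0) V)\<^sup>2"
      using dr[of t] by (intro mult_left_mono power_mono) auto
    finally have "(\<Sum>u\<in>V. d t u)\<^sup>2 \<le> ?N * (r ^ t * L2_set (d 0) V)\<^sup>2" .
    then have "?W * (\<Sum>u\<in>V. d t u)\<^sup>2 \<le> ?W * (?N * (r ^ t * L2_set (d 0) V)\<^sup>2)"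
      using weight_pos by (intro mult_left_mono sum_nonneg) (auto intro: less_imp_le)
    then show "b t \<le> (?W * ?N * (L2_set (d 0) V)\<^sup>2) * (r\<^sup>2) ^ t"
      using pair_le_oscillation[OF osc mean_g, of t]
      by (simp add: b_def power_mult_distrib power_mult[symmetric] mult_ac)
  qed
  moreover have "(pair f (glauber f))\<^sup>2 \<le> b 0 * b 1"
    using pair_Cauchy_Schwarz[of f "glauber f"] by (simp add: b_def g_def)
  ultimately have "(pair f (glauber f))\<^sup>2 \<le> b 0 * (r\<^sup>2 * b 0)"
    using mult_left_mono[of "b 1" "r\<^sup>2 * b 0" "b 0"] pair_self_nonneg[of "g 0"] by (simp add: b_def)
  then have "(pair f (glauber f))\<^sup>2 \<le> (r * b 0)\<^sup>2" by (simp add: power2_eq_square mult_ac)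
  then have "pair f (glauber f) \<le> r * b 0"
    by (rule power2_le_imp_le) (use r pair_self_nonneg[of "g 0"] in \<open>simp add: b_def\<close>)
  then show ?thesis by (simp add: r_def b_def g_def)
qed

end

section \<open>The quadratic form of the adjacency matrix\<close>

lemma sum_min_le:
  fixes a :: "'v \<Rightarrow> 'v \<Rightarrow> real" and K :: real
  assumes "finite V" "\<And>u v. 0 \<le> a u v"
    and "\<And>S. S \<subseteq> V \<Longrightarrow> (\<Sum>u\<in>S. \<Sum>v\<in>S. a u v) \<le> K * card S"
    and "\<And>u. u \<in> V \<Longrightarrow> 0 \<le> y u"
  shows "(\<Sum>u\<in>V. \<Sum>v\<in>V. a u v * min (y u) (y v)) \<le> K * (\<Sum>u\<in>V. y u)"
  using assms
proof (induction "card V" arbitrary: V y)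
  case 0
  then show ?case by simp
next
  case (Suc n)
  then have "V \<noteq> {}" by auto
  then obtain w where w: "w \<in> V" "\<And>u. u \<in> V \<Longrightarrow> y w \<le> y u"
    using Suc.prems(1) by (metis arg_min_if_finite(1) arg_min_least)
  let ?y = "\<lambda>u. y u - y w"
  have fin: "finite (V - {w})" using Suc.prems(1) by simp
  have "(\<Sum>u\<in>V. \<Sum>v\<in>V. a u v * min (?y u) (?y v)) =
      (\<Sum>u\<in>V - {w}. \<Sum>v\<in>V - {w}. a u v * min (?y u) (?y v))"
  proof -
    have 0: "min (?y w) (?y u) = 0" "min (?y u) (?y w) = 0" if "u \<in> V" for u
      using w(2)[OF that] by auto
    have "(\<Sum>v\<in>V. a u v * min (?y u) (?y v)) = (\<Sum>v\<in>V - {w}. a u v * min (?y u) (?y v))" if "u \<in> V" for u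
      using 0 that w(1) Suc.prems(1) by (intro sum.mono_neutral_right) auto
    moreover have "(\<Sum>u\<in>V. \<Sum>v\<in>V - {w}. a u v * min (?y u) (?y v)) =
        (\<Sum>u\<in>V - {w}. \<Sum>v\<in>V - {w}. a u v * min (?y u) (?y v))"
      using 0 w(1) Suc.prems(1) by (intro sum.mono_neutral_right) auto
    ultimately show ?thesis by simp
  qed
  also have "\<dots> \<le> K * (\<Sum>u\<in>V - {w}. ?y u)"
  proof (rule Suc.hyps(1))
    show "n = card (V - {w})" using Suc.hyps(2) w(1) by simp
    show "(\<Sum>u\<in>S. \<Sum>v\<in>S. a u v) \<le> K * card S" if "S \<subseteq> V - {w}" for S
      using that by (intro Suc.prems(3)) auto
  qed (use fin Suc.prems(2) w in auto)
  also have "(\<Sum>u\<in>V - {w}. ?y u) = (\<Sum>u\<in>V. ?y u)"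
    using w(1) Suc.prems(1) by (intro sum.mono_neutral_left) auto
  finally have IH: "(\<Sum>u\<in>V. \<Sum>v\<in>V. a u v * min (?y u) (?y v)) \<le> K * (\<Sum>u\<in>V. ?y u)" .
  have "a u v * min (y u) (y v) = a u v * min (?y u) (?y v) + y w * a u v" for u v
    by (simp add: min_def algebra_simps)
  then have "(\<Sum>u\<in>V. \<Sum>v\<in>V. a u v * min (y u) (y v)) =
      (\<Sum>u\<in>V. \<Sum>v\<in>V. a u v * min (?y u) (?y v)) + y w * (\<Sum>u\<in>V. \<Sum>v\<in>V. a u v)"
    by (simp add: sum.distrib sum_distrib_left)
  also have "\<dots> \<le> K * (\<Sum>u\<in>V. ?y u) + y w * (K * card V)"
    using IH Suc.prems(3)[of V] Suc.prems(4)[OF w(1)] by (intro add_mono mult_left_mono) auto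
  also have "\<dots> = K * (\<Sum>u\<in>V. y u)" by (simp add: sum_subtractf algebra_simps)
  finally show ?case .
qed

text \<open>Weighted arithmetic-geometric mean with factor \<open>t\<close> on the smaller square
  and \<open>1 / t\<close> on the larger one, the larger being the sum minus the minimum.\<close>

lemma two_mult_le_min:
  fixes x y t :: real
  assumes "0 < t"
  shows "2 * (x * y) \<le> (t - 1 / t) * min (x\<^sup>2) (y\<^sup>2) + (x\<^sup>2 + y\<^sup>2) / t"
proof -
  have le: "2 * (x * y) \<le> t * x\<^sup>2 + y\<^sup>2 / t" for x y :: real
  proof -
    have "0 \<le> (t * x - y)\<^sup>2 / t" using assms by simp
    also have "\<dots> = t * x\<^sup>2 + y\<^sup>2 / t - 2 * (x * y)"
      using assms by (simp add: power2_eq_square field_simps)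
    finally show ?thesis by simp
  qed
  have eq: "(t - 1 / t) * b + (b + d) / t = t * b + d / t" for b d :: real
    by (simp add: left_diff_distrib add_divide_distrib)
  show ?thesis
    using le[of x y] le[of y x] eq[of "x\<^sup>2" "y\<^sup>2"] eq[of "y\<^sup>2" "x\<^sup>2"]
    by (cases "x\<^sup>2 \<le> y\<^sup>2") (simp_all add: min_def mult.commute add.commute)
qed

context potts begin

lemma adj_commute: "adj u v = adj v u"
  by (simp add: adj_def insert_commute)

lemma sum_adj_le:
  assumes "S \<subseteq> V" "u \<in> S"
  shows "(\<Sum>v\<in>S. adj u v) \<le> card {e \<in> E. e \<subseteq> S \<and> u \<in> e}"
proof -
  have fin: "finite S" using assms(1) finite_V finite_subset by auto
  have "(\<Sum>v\<in>S. adj u v) = card {v \<in> S. {u, v} \<in> E}"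
    using fin by (simp add: adj_def sum.inter_filter[symmetric])
  also have "\<dots> = card ((\<lambda>v. {u, v}) ` {v \<in> S. {u, v} \<in> E})"
    by (subst card_image) (auto simp: inj_on_def doubleton_eq_iff)
  also have "\<dots> \<le> card {e \<in> E. e \<subseteq> S \<and> u \<in> e}"
    using assms(2) finite_E by (intro of_nat_mono card_mono) auto
  finally show ?thesis .
qed

lemma sum_adj_squares_le:
  fixes z :: "'v \<Rightarrow> real"
  shows "(\<Sum>u\<in>V. \<Sum>v\<in>V. adj u v * ((z u)\<^sup>2 + (z v)\<^sup>2)) \<le> 2 * (max_deg * (\<Sum>u\<in>V. (z u)\<^sup>2))"
proof -
  have "(\<Sum>u\<in>V. \<Sum>v\<in>V. adj u v * (z v)\<^sup>2) = (\<Sum>u\<in>V. \<Sum>v\<in>V. adj u v * (z u)\<^sup>2)"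
    by (subst sum.swap) (simp add: adj_commute)
  then have "(\<Sum>u\<in>V. \<Sum>v\<in>V. adj u v * ((z u)\<^sup>2 + (z v)\<^sup>2)) = 2 * (\<Sum>u\<in>V. (\<Sum>v\<in>V. adj u v) * (z u)\<^sup>2)"
    by (simp add: distrib_left sum.distrib sum_distrib_right)
  also have "(\<Sum>u\<in>V. (\<Sum>v\<in>V. adj u v) * (z u)\<^sup>2) \<le> (\<Sum>u\<in>V. max_deg * (z u)\<^sup>2)"
  proof (intro sum_mono mult_right_mono)
    fix u assume u: "u \<in> V"
    have "card {e \<in> E. e \<subseteq> V \<and> u \<in> e} \<le> card {e \<in> E. u \<in> e}"
      using finite_E by (intro card_mono) auto
    then show "(\<Sum>v\<in>V. adj u v) \<le> max_deg"
      using sum_adj_le[of V u] degree_le[OF u] u by simp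
  qed simp
  finally show ?thesis by (simp add: sum_distrib_left)
qed

lemma adjacency_form_le:
  fixes z :: "'v \<Rightarrow> real"
  shows "(\<Sum>u\<in>V. \<Sum>v\<in>V. adj u v * (z u * z v)) \<le> max_deg * (\<Sum>u\<in>V. (z u)\<^sup>2)"
proof -
  have "2 * (z u * z v) \<le> (z u)\<^sup>2 + (z v)\<^sup>2" for u v
    using sum_squares_bound[of "z u" "z v"] by simp
  then have "(\<Sum>u\<in>V. \<Sum>v\<in>V. adj u v * (2 * (z u * z v))) \<le> (\<Sum>u\<in>V. \<Sum>v\<in>V. adj u v * ((z u)\<^sup>2 + (z v)\<^sup>2))"
    by (intro sum_mono mult_left_mono) (auto simp: adj_def)
  also have "\<dots> \<le> 2 * (max_deg * (\<Sum>u\<in>V. (z u)\<^sup>2))" by (rule sum_adj_squares_le)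
  finally have "2 * (\<Sum>u\<in>V. \<Sum>v\<in>V. adj u v * (z u * z v)) \<le> 2 * (max_deg * (\<Sum>u\<in>V. (z u)\<^sup>2))"
    by (simp add: sum_distrib_left mult_ac)
  then show ?thesis by simp
qed

text \<open>Every edge inside \<open>S\<close> is counted in both directions, so 6 is twice the 3 of
  the planar edge bound.\<close>

lemma sum_adj_planar_le:
  assumes planar: "planar_graph V E" and S: "S \<subseteq> V"
  shows "(\<Sum>u\<in>S. \<Sum>v\<in>S. adj u v) \<le> 6 * card S"
proof -
  let ?E = "{e \<in> E. e \<subseteq> S}"
  have fin: "finite S" "finite ?E" using S finite_V finite_E finite_subset by auto
  have "(\<Sum>u\<in>S. \<Sum>v\<in>S. adj u v) \<le> (\<Sum>u\<in>S. real (card {e \<in> ?E. u \<in> e}))"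
    using sum_adj_le[OF S] by (intro sum_mono) simp
  also have "\<dots> = real (\<Sum>u\<in>S. card {e \<in> ?E. u \<in> e})" by simp
  also have "(\<Sum>u\<in>S. card {e \<in> ?E. u \<in> e}) = (\<Sum>e\<in>?E. card {u \<in> S. u \<in> e})"
    by (rule sum_multicount_gen[OF fin]) simp
  also have "\<dots> = (\<Sum>e\<in>?E. 2)"
  proof (rule sum.cong[OF refl])
    fix e assume "e \<in> ?E"
    then have "{u \<in> S. u \<in> e} = e" "card e = 2" using E_nsets by (auto simp: nsets_def)
    then show "card {u \<in> S. u \<in> e} = 2" by simp
  qed
  also have "\<dots> = 2 * card ?E" by simp
  also have "card ?E \<le> 3 * card S"
  proof (rule planar_graph_card_edges)
    show "finite_simple_graph S ?E"
      using fin E_nsets by (auto simp: finite_simple_graph_def nsets_def)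
    show "planar_graph S ?E" by (rule planar_graph_induced[OF planar S])
  qed
  finally show ?thesis by simp
qed

text \<open>With \<open>t\<close> as below the two terms of \<open>3 * t + (D - 3) / t\<close>, \<open>D\<close> the maximum degree, are equal; \<open>6 \<le> D\<close> gives \<open>1 \<le> t\<close>.\<close>

lemma adjacency_form_planar_le:
  fixes z :: "'v \<Rightarrow> real"
  assumes planar: "planar_graph V E" and deg: "6 \<le> max_deg"
  shows "(\<Sum>u\<in>V. \<Sum>v\<in>V. adj u v * (z u * z v)) \<le> 2 * sqrt (3 * (real max_deg - 3)) * (\<Sum>u\<in>V. (z u)\<^sup>2)"
proof -
  define t where "t = sqrt ((real max_deg - 3) / 3)"
  let ?Z = "\<Sum>u\<in>V. (z u)\<^sup>2"
  have t: "1 \<le> t" using deg by (simp add: t_def)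
  have t2: "t * t = (real max_deg - 3) / 3" using deg by (simp add: t_def)
  have "(3 * t)\<^sup>2 = 3 * (real max_deg - 3)" using t2 by (simp add: power2_eq_square)
  then have s: "sqrt (3 * (real max_deg - 3)) = 3 * t" using t by (metis real_sqrt_unique zero_le_mult_iff
      zero_le_numeral order.trans zero_le_one)
  have "(\<Sum>u\<in>V. \<Sum>v\<in>V. adj u v * (2 * (z u * z v))) \<le>
      (\<Sum>u\<in>V. \<Sum>v\<in>V. adj u v * ((t - 1 / t) * min ((z u)\<^sup>2) ((z v)\<^sup>2) + ((z u)\<^sup>2 + (z v)\<^sup>2) / t))"
    using t by (intro sum_mono mult_left_mono two_mult_le_min) (auto simp: adj_def)
  also have "\<dots> = (t - 1 / t) * (\<Sum>u\<in>V. \<Sum>v\<in>V. adj u v * min ((z u)\<^sup>2) ((z v)\<^sup>2)) +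
      (\<Sum>u\<in>V. \<Sum>v\<in>V. adj u v * ((z u)\<^sup>2 + (z v)\<^sup>2)) / t"
  proof -
    have "adj u v * ((t - 1 / t) * min ((z u)\<^sup>2) ((z v)\<^sup>2) + ((z u)\<^sup>2 + (z v)\<^sup>2) / t) =
        (t - 1 / t) * (adj u v * min ((z u)\<^sup>2) ((z v)\<^sup>2)) + adj u v * ((z u)\<^sup>2 + (z v)\<^sup>2) / t" for u v
      by (simp only: distrib_left mult.left_commute times_divide_eq_right)
    then show ?thesis by (simp only: sum.distrib sum_distrib_left sum_divide_distrib)
  qed
  also have "\<dots> \<le> (t - 1 / t) * (6 * ?Z) + 2 * (max_deg * ?Z) / t"
  proof (intro add_mono mult_left_mono divide_right_mono)
    show "(\<Sum>u\<in>V. \<Sum>v\<in>V. adj u v * min ((z u)\<^sup>2) ((z v)\<^sup>2)) \<le> 6 * ?Z"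
      using sum_adj_planar_le[OF planar] by (intro sum_min_le[OF finite_V]) (auto simp: adj_def)
    show "0 \<le> t - 1 / t" using t by (simp add: field_simps) (metis mult_mono' mult_1 zero_le_one)
  qed (use t sum_adj_squares_le in auto)
  also have "\<dots> = 2 * (2 * (3 * t) * ?Z)"
  proof -
    have "real max_deg = 3 * (t * t) + 3" using t2 by simp
    then show ?thesis using t by (simp add: field_simps)
  qed
  finally have "2 * (\<Sum>u\<in>V. \<Sum>v\<in>V. adj u v * (z u * z v)) \<le> 2 * (2 * (3 * t) * ?Z)"
    by (simp add: sum_distrib_left mult_ac)
  then show ?thesis unfolding s by simp
qed

lemma sw_spectral_gap_ge:
  assumes q: "2 \<le> q" and \<rho>: "0 < \<rho>" and V: "V \<noteq> {}" and \<epsilon>: "\<beta> * \<rho> / 2 \<le> 1 - \<epsilon>"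
    and form: "\<And>z. (\<Sum>u\<in>V. \<Sum>v\<in>V. adj u v * (z u * z v)) \<le> \<rho> * (\<Sum>u\<in>V. (z u)\<^sup>2)"
  shows "exp (- \<beta> * max_deg) * (\<epsilon> / card V) \<le> spectral_gap \<Omega> (sw_kernel V E \<beta> q)"
proof -
  let ?N = "real (card V)" and ?x = "exp (- \<beta> * max_deg)"
  let ?form = "\<lambda>f. \<Sum>\<sigma>\<in>\<Omega>. weight \<sigma> * f \<sigma> * (\<Sum>\<tau>\<in>\<Omega>. sw_kernel V E \<beta> q \<sigma> \<tau> * f \<tau>)"
  have N: "0 < ?N" using V finite_V by (simp add: card_gt_0_iff)
  have "1 - (1 - ?x * (\<epsilon> / ?N)) \<le> spectral_gap \<Omega> (sw_kernel V E \<beta> q)"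
  proof (rule spectral_gap_ge[OF finite_configs _ weight_pos reversible_weight])
    have "card \<Omega> = q ^ card V" by (simp add: potts_configs_def card_PiE finite_V)
    moreover have "q ^ 1 \<le> q ^ card V" using N q by (intro power_increasing) auto
    ultimately show "2 \<le> card \<Omega>" using q by simp
    show "0 \<le> ?form f" for f
      unfolding sw_form using \<beta>_nonneg by (intro sum_nonneg mult_nonneg_nonneg) auto
  next
    fix f assume "(\<Sum>\<sigma>\<in>\<Omega>. weight \<sigma> * f \<sigma>) = 0"
    then have "pair f (\<lambda>_. 1) = 0" by (simp add: pair_def)
    note glauber_poincare[OF \<rho> V form this]
    also have "(1 - 1 / ?N + \<beta> * \<rho> / (2 * ?N)) * pair f f \<le> (1 - \<epsilon> / ?N) * pair f f"
    proof (rule mult_right_mono[OF _ pair_self_nonneg])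
      have "(\<beta> * \<rho> / 2) / ?N \<le> (1 - \<epsilon>) / ?N" using \<epsilon> N by (intro divide_right_mono) auto
      then show "1 - 1 / ?N + \<beta> * \<rho> / (2 * ?N) \<le> 1 - \<epsilon> / ?N" by (simp add: diff_divide_distrib)
    qed
    finally have "\<epsilon> / ?N * pair f f \<le> pair f f - pair f (glauber f)"
      by (simp add: left_diff_distrib)
    then have "?x * (\<epsilon> / ?N * pair f f) \<le> ?x * (pair f f - pair f (glauber f))"
      by (intro mult_left_mono) auto
    also have "\<dots> \<le> pair f f - ?form f" by (rule sw_glauber_comparison[OF V])
    finally have "?form f \<le> (1 - ?x * (\<epsilon> / ?N)) * pair f f" by (simp add: algebra_simps)
    then show "?form f \<le> (1 - ?x * (\<epsilon> / ?N)) * (\<Sum>\<sigma>\<in>\<Omega>. weight \<sigma> * (f \<sigma>)\<^sup>2)"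
      by (simp add: pair_def power2_eq_square mult.assoc)
  qed
  then show ?thesis by simp
qed

end

section \<open>Constants and the final estimate\<close>

lemma two_le_card_vertices:
  assumes "finite_simple_graph V E" "1 \<le> max_degree V E"
  shows "2 \<le> card V"
proof -
  have V: "finite V" "E \<subseteq> nsets V 2" using assms(1) by (auto simp: finite_simple_graph_def)
  have "max_degree V E \<in> insert 0 (vertex_degree E ` V)"
    unfolding max_degree_def using V by (intro Max_in) auto
  then obtain v where "max_degree V E = vertex_degree E v" using assms(2) by auto
  then have "vertex_degree E v \<noteq> 0" using assms(2) by simp
  then have "{e \<in> E. v \<in> e} \<noteq> {}" unfolding vertex_degree_def by (metis card.empty)
  then obtain e where "e \<in> E" by auto
  then have "e \<subseteq> V" "card e = 2" using V by (auto simp: nsets_def)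
  then show ?thesis using card_mono[OF V(1), of e] by simp
qed

text \<open>The factor 2 on the left is reserved for \<open>ln N\<close>, which may be smaller than
  1 but is at least \<open>ln 2\<close>, hence at least \<open>1 / 2\<close>.\<close>

lemma exp_le_inverse_c_SW:
  assumes q: "2 \<le> q" and \<beta>: "0 \<le> \<beta>" and c: "inverse c = 1 / 4 * c_SW V E \<beta> q"
  shows "2 * exp (\<beta> * max_degree V E) \<le> c"
proof -
  let ?D = "max_degree V E" and ?y = "real q * exp (2 * \<beta>)"
  have y: "?y powi (- 4 * int ?D) = inverse (?y ^ (4 * ?D))"
  proof -
    have "- 4 * int ?D = - int (4 * ?D)" by simp
    then show ?thesis by (simp only: power_int_minus power_int_of_nat)
  qed
  have "c = inverse (inverse c)" by simp
  also have "\<dots> = 8 * (real q)\<^sup>2 * ?y ^ (4 * ?D)"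
    unfolding c c_SW_def y using q by (simp add: field_simps)
  finally have ceq: "c = 8 * (real q)\<^sup>2 * ?y ^ (4 * ?D)" .
  have "exp (\<beta> * ?D) \<le> exp (2 * \<beta>) ^ (4 * ?D)"
  proof -
    have "\<beta> * ?D \<le> 8 * (\<beta> * ?D)" using \<beta> by simp
    then show ?thesis by (simp add: exp_of_nat2_mult[symmetric] mult_ac)
  qed
  also have "\<dots> \<le> ?y ^ (4 * ?D)" using q by (intro power_mono) auto
  finally have "exp (\<beta> * ?D) \<le> ?y ^ (4 * ?D)" .
  moreover have "1 \<le> (real q)\<^sup>2" using q by (intro one_le_power) simp
  then have "2 \<le> 8 * (real q)\<^sup>2" by linarith
  ultimately show ?thesis unfolding ceq by (intro mult_mono) auto
qed

text \<open>Positivity of the gap is part of the claim because \<open>inverse\<close> sends zero to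
  zero and negative numbers to negative ones, so the second conjunct alone would not exclude a gap
  that fails to be positive.\<close>

theorem corollary3:
  fixes V :: "'v set" and E :: "'v set set"
    and N \<Delta> q :: nat and \<epsilon> \<beta> c :: real
  assumes "finite_simple_graph V E"
    and "N = card V"
    and "\<Delta> = max_degree V E" and "\<Delta> \<ge> 1"
    and "q \<ge> 2" and "\<epsilon> > 0" and "\<beta> \<ge> 0"
    and "inverse c = 1 / 4 * c_SW V E \<beta> q"
    and "\<beta> \<le> 2 * ((1 - \<epsilon>) / real \<Delta>) \<or>
         (planar_graph V E \<and> \<Delta> \<ge> 6 \<and> \<beta> \<le> (1 - \<epsilon>) / sqrt (3 * (real \<Delta> - 3)))"
  shows "0 < spectral_gap (potts_configs V q) (sw_kernel V E \<beta> q) \<and>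
         inverse (spectral_gap (potts_configs V q) (sw_kernel V E \<beta> q))
           \<le> c / \<epsilon> * (real N * ln (real N))"
proof -
  interpret potts V E \<beta> q using assms by unfold_locales auto
  have N: "2 \<le> N" using two_le_card_vertices[OF assms(1)] assms(2,3,4) by simp
  then have V: "V \<noteq> {}" using assms(2) by auto
  let ?g = "spectral_gap (potts_configs V q) (sw_kernel V E \<beta> q)"
  have gap: "exp (- \<beta> * \<Delta>) * (\<epsilon> / N) \<le> ?g"
    using assms(9)
  proof
    assume "\<beta> \<le> 2 * ((1 - \<epsilon>) / real \<Delta>)"
    then have "\<beta> \<le> 2 * (1 - \<epsilon>) / \<Delta>" by (simp only: times_divide_eq_right)
    moreover have "0 < real \<Delta>" using assms(4) by linarith
    ultimately have "\<beta> * \<Delta> \<le> 2 * (1 - \<epsilon>)" by (simp only: pos_le_divide_eq)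
    then have "\<beta> * \<Delta> / 2 \<le> 1 - \<epsilon>" by simp
    then show ?thesis
      using sw_spectral_gap_ge[OF assms(5) _ V, of \<Delta> \<epsilon>] adjacency_form_le assms(2,3,4) by simp
  next
    let ?s = "sqrt (3 * (real \<Delta> - 3))"
    assume *: "planar_graph V E \<and> \<Delta> \<ge> 6 \<and> \<beta> \<le> (1 - \<epsilon>) / ?s"
    then have s: "0 < ?s" by simp
    then have "\<beta> * (2 * ?s) / 2 \<le> 1 - \<epsilon>" using * by (simp add: le_divide_eq)
    then show ?thesis
      using sw_spectral_gap_ge[OF assms(5) _ V, of "2 * ?s" \<epsilon>] adjacency_form_planar_le * s assms(2,3) by simp
  qed
  have pos: "0 < exp (- \<beta> * \<Delta>) * (\<epsilon> / N)" using assms(6) N by simp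
  have "inverse ?g \<le> inverse (exp (- \<beta> * \<Delta>) * (\<epsilon> / N))"
    using gap pos by (rule le_imp_inverse_le)
  also have "\<dots> = exp (\<beta> * \<Delta>) / \<epsilon> * N"
    by (simp add: exp_minus field_simps)
  also have "\<dots> \<le> (c * ln N) / \<epsilon> * N"
  proof (intro mult_right_mono divide_right_mono)
    have "2 * exp (\<beta> * \<Delta>) \<le> c" using exp_le_inverse_c_SW[OF assms(5,7,8)] assms(3) by simp
    moreover have "1 / 2 \<le> ln (real N)"
    proof -
      have "1 / 2 \<le> ln (2 :: real)" using ln_le_minus_one[of "1 / 2"] by (simp add: ln_div)
      also have "\<dots> \<le> ln (real N)" using N by simp
      finally show ?thesis .
    qed
    ultimately have "(2 * exp (\<beta> * \<Delta>)) * (1 / 2) \<le> c * ln N"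
      by (intro mult_mono) (auto intro: order.trans[rotated])
    then show "exp (\<beta> * \<Delta>) \<le> c * ln N" by simp
  qed (use assms(6) in auto)
  also have "\<dots> = c / \<epsilon> * (real N * ln (real N))" by simp
  finally show ?thesis using gap pos by linarith
qed

end
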